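(* Let $F$ be a Boolean circuit, let $(T,\mathbf{G})$ be a type-respecting simplified clique decomposition of $F$, and let $F^*$ be the circuit constructed from $F$ and $(T,\mathbf{G})$ as described in the context. Then $F^*$ is a well-formed (in particular acyclic) circuit, and the output of each original gate $g$ of $F^*$ computes exactly the same Boolean function of the input variables as $g$ computes in $F$ ($F$ and $F^*$ have the same input gates).
   Context: Boolean circuits are over $\{\vee,\wedge,\neg\}$: input gates (no inputs), NOT gates (one input), AND/OR gates (positive fan-in), no constant gates; "a wire from $g_1$ to $g_2$" means the output of $g_1$ feeds an input of $g_2$; the DAG of a circuit has an arc per wire. A labeled directed graph is $(V,E,\mathbf{S})$ with $\mathbf{S}$ a partition of $V$ into labels. A simplified clique decomposition (SCD) $(T,\mathbf{G})$: rooted tree $T$, each node having at most two children, each node $t$ carrying a labeled directed graph $G(t)$; a leaf carries $(\{v\},\emptyset,\{\{v\}\})$; a node with two children carries the union of the vertex-disjoint graphs of its children; a node with one child $t_1$ carries $G(t_1)$ modified by (i) adding a new vertex $v$ as singleton label, or (ii) union of two labels $S_1,S_2$ into $S=S_1\cup S_2$ ($S_1,S_2$ are then the children of $S$), or (iii) new adjacency: adding all arcs from every vertex of label $S_1$ to every vertex of label $S_2$ (we then say there is an arc from $S_1$ to $S_2$). The set of labels of $(T,\mathbf{G})$ is $\bigcup_t \mathbf{S}(G(t))$; its width is $\max_t|\mathbf{S}(G(t))|$; it is an SCD of $F$ if the unlabeled graph at the root is the DAG of $F$. It is type-respecting if each non-singleton label is a unary label (only input and NOT gates), an AND label (only AND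 gates) or an OR label (only OR gates); a singleton label $\{g\}$ has the type of $g$ (input or NOT gate: unary). Construction of $F^*$. Gates: each singleton label $\{g\}$ is associated with the gate $g$ of $F$ (an original gate), and we set $oand(\{g\})=oor(\{g\})=in(\{g\})=g$. Each non-singleton label $S$ gets a new AND gate $oand(S)$ and a new OR gate $oor(S)$, and, if $S$ contains no input gates, a further gate $in(S)$ which is an AND gate if $S$ is an AND label, an OR gate if $S$ is an OR label, and, if $S$ is unary, a chain of two NOT gates (input of the first is the input of $in(S)$, output of the second is the output of $in(S)$). Wires: (child-parent) if $S_1$ is a child of $S_2$, wires from $oand(S_1)$ to $oand(S_2)$ and from $oor(S_1)$ to $oor(S_2)$; (parent-child) if $S_1$ is a child of $S_2$ and $S_2$ contains no input gates, a wire from $in(S_2)$ to $in(S_1)$; (adjacency) if there is an arc from $S_1$ to $S_2$: a wire from $oand(S_1)$ to $in(S_2)$ if $S_2$ is an AND label, from $oor(S_1)$ to $in(S_2)$ if $S_2$ is an OR label, and from one arbitrary of $oand(S_1),oor(S_1)$ to $in(S_2)$ if $S_2$ is a unary label consisting of NOT gates only. Finally, $in(S)$ gates having no inputs are removed, iteratively.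
   Formalization: Arcs and wires are counted with multiplicity: a new adjacency between already adjacent vertices adds parallel arcs, so each NOT gate's input wire comes from one adjacency step; if re-adding an arc were a no-op, a NOT gate could receive two wires in F* and the claim would fail. *)

theory Defs
  imports "HOL-Library.Multiset" "HOL-Library.Disjoint_Sets"
begin

section \<open>Boolean circuits\<close>

datatype 'x gate_kind = is_Input_Gate: Input_Gate 'x | Not_Gate | And_Gate | Or_Gate

text \<open>
  An input gate carries its input variable, of type \<open>'x\<close>. A pair \<open>(g, h)\<close> in \<open>wires\<close> means that the
  output of \<open>g\<close> feeds an input of \<open>h\<close>. The wires form a multiset because gates may be joined by
  parallel wires, each of which is an arc of its own in the DAG of the circuit; in particular the
  fan-in of a gate counts wires.
\<close>

record ('g, 'x) circuit =
  gates :: "'g set"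
  kind :: "'g \<Rightarrow> 'x gate_kind"
  wires :: "('g \<times> 'g) multiset"

definition fan_in :: "('g, 'x) circuit \<Rightarrow> 'g \<Rightarrow> nat" where
  "fan_in C g = size {#e \<in># wires C. snd e = g#}"

fun fan_in_ok :: "'x gate_kind \<Rightarrow> nat \<Rightarrow> bool" where
  "fan_in_ok (Input_Gate x) n \<longleftrightarrow> n = 0"
| "fan_in_ok Not_Gate n \<longleftrightarrow> n = 1"
| "fan_in_ok And_Gate n \<longleftrightarrow> n > 0"
| "fan_in_ok Or_Gate n \<longleftrightarrow> n > 0"

definition well_formed_circuit :: "('g, 'x) circuit \<Rightarrow> bool" where
  "well_formed_circuit C \<longleftrightarrow>
     finite (gates C) \<and>
     set_mset (wires C) \<subseteq> gates C \<times> gates C \<and>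
     acyclic (set_mset (wires C)) \<and>
     (\<forall>g\<in>gates C. fan_in_ok (kind C g) (fan_in C g))"

definition input_gates :: "('g, 'x) circuit \<Rightarrow> 'g set" where
  "input_gates C = {g \<in> gates C. is_Input_Gate (kind C g)}"

definition gate_step ::
    "('g, 'x) circuit \<Rightarrow> ('x \<Rightarrow> bool) \<Rightarrow> ('g \<Rightarrow> bool) \<Rightarrow> 'g \<Rightarrow> bool" where
  "gate_step C \<alpha> val g =
     (case kind C g of
        Input_Gate x \<Rightarrow> \<alpha> x
      | Not_Gate \<Rightarrow> \<not> val (THE h. (h, g) \<in># wires C)
      | And_Gate \<Rightarrow> (\<forall>h. (h, g) \<in># wires C \<longrightarrow> val h)
      | Or_Gate \<Rightarrow> (\<exists>h. (h, g) \<in># wires C \<and> val h))"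

definition gate_value :: "('g, 'x) circuit \<Rightarrow> ('x \<Rightarrow> bool) \<Rightarrow> 'g \<Rightarrow> bool" where
  "gate_value C \<alpha> = wfrec (set_mset (wires C)) (gate_step C \<alpha>)"

definition gate_function :: "('g, 'x) circuit \<Rightarrow> 'g \<Rightarrow> ('x \<Rightarrow> bool) \<Rightarrow> bool" where
  "gate_function C g = (\<lambda>\<alpha>. gate_value C \<alpha> g)"

lemma fan_in_one_ex1:
  assumes "fan_in C g = 1"
  shows "\<exists>!h. (h, g) \<in># wires C"
proof -
  obtain e where e: "{#e \<in># wires C. snd e = g#} = {#e#}"
    using assms unfolding fan_in_def by (metis size_1_singleton_mset)
  have iff: "(h, g) \<in># wires C \<longleftrightarrow> (h, g) = e" for h
  proof -
    have "(h, g) \<in># wires C \<longleftrightarrow> (h, g) \<in># {#e \<in># wires C. snd e = g#}" by simp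
    then show ?thesis unfolding e by simp
  qed
  have "e \<in># {#e \<in># wires C. snd e = g#}" unfolding e by simp
  then have "e = (fst e, g)" by auto
  then show ?thesis using iff by (metis fst_conv)
qed

lemma gate_value_unfold:
  assumes C: "well_formed_circuit C" and g: "g \<in> gates C"
  shows "gate_value C \<alpha> g = gate_step C \<alpha> (gate_value C \<alpha>) g"
proof -
  let ?r = "set_mset (wires C)"
  have wf: "wf ?r"
    using C by (simp add: well_formed_circuit_def finite_acyclic_wf)
  have the: "((THE h. (h, g) \<in># wires C), g) \<in># wires C" if "kind C g = Not_Gate"
  proof -
    have "fan_in C g = 1" using C g that by (force simp: well_formed_circuit_def)
    from theI'[OF fan_in_one_ex1[OF this]] show ?thesis .
  qed
  have "gate_value C \<alpha> g = gate_step C \<alpha> (cut (gate_value C \<alpha>) ?r g) g"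
    unfolding gate_value_def by (rule wfrec[OF wf])
  also have "\<dots> = gate_step C \<alpha> (gate_value C \<alpha>) g"
    using the by (auto simp: gate_step_def cut_def split: gate_kind.splits)
  finally show ?thesis .
qed


section \<open>Simplified clique decompositions\<close>

text \<open>
  As the DAG of a circuit has one arc per wire, the arcs of a graph form a multiset as well: adding
  arcs between vertices that are already adjacent creates parallel arcs. This matters for NOT gates,
  whose single input wire must then be introduced by a single adjacency operation.
\<close>

record 'v labeled_graph =
  verts :: "'v set"
  arcs :: "('v \<times> 'v) multiset"
  labels :: "'v set set"

text \<open>
  The tree of a decomposition, with each inner node recording its operation: \<open>Join\<close> is a node with
  two children, \<open>Add_Vertex\<close>, \<open>Merge\<close> and \<open>Adjacency\<close> are nodes with one child. The labeled graph
  carried by a node is computed from the subtree rooted there.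
\<close>

datatype 'v scd =
  Leaf 'v
| Join "'v scd" "'v scd"
| Add_Vertex 'v "'v scd"
| Merge "'v set" "'v set" "'v scd"
| Adjacency "'v set" "'v set" "'v scd"

fun graph_at :: "'v scd \<Rightarrow> 'v labeled_graph" where
  "graph_at (Leaf v) = \<lparr>verts = {v}, arcs = {#}, labels = {{v}}\<rparr>"
| "graph_at (Join t1 t2) =
     \<lparr>verts = verts (graph_at t1) \<union> verts (graph_at t2),
      arcs = arcs (graph_at t1) + arcs (graph_at t2),
      labels = labels (graph_at t1) \<union> labels (graph_at t2)\<rparr>"
| "graph_at (Add_Vertex v t) =
     \<lparr>verts = insert v (verts (graph_at t)),
      arcs = arcs (graph_at t),
      labels = insert {v} (labels (graph_at t))\<rparr>"
| "graph_at (Merge S1 S2 t) =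
     \<lparr>verts = verts (graph_at t),
      arcs = arcs (graph_at t),
      labels = insert (S1 \<union> S2) (labels (graph_at t) - {S1, S2})\<rparr>"
| "graph_at (Adjacency S1 S2 t) =
     \<lparr>verts = verts (graph_at t),
      arcs = arcs (graph_at t) + mset_set (S1 \<times> S2),
      labels = labels (graph_at t)\<rparr>"

fun valid_scd :: "'v scd \<Rightarrow> bool" where
  "valid_scd (Leaf v) \<longleftrightarrow> True"
| "valid_scd (Join t1 t2) \<longleftrightarrow>
     valid_scd t1 \<and> valid_scd t2 \<and> verts (graph_at t1) \<inter> verts (graph_at t2) = {}"
| "valid_scd (Add_Vertex v t) \<longleftrightarrow> valid_scd t \<and> v \<notin> verts (graph_at t)"
| "valid_scd (Merge S1 S2 t) \<longleftrightarrow>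
     valid_scd t \<and> S1 \<in> labels (graph_at t) \<and> S2 \<in> labels (graph_at t) \<and> S1 \<noteq> S2"
| "valid_scd (Adjacency S1 S2 t) \<longleftrightarrow>
     valid_scd t \<and> S1 \<in> labels (graph_at t) \<and> S2 \<in> labels (graph_at t)"

text \<open>Nodes are represented by the subtrees rooted at them.\<close>

fun nodes :: "'v scd \<Rightarrow> 'v scd set" where
  "nodes (Leaf v) = {Leaf v}"
| "nodes (Join t1 t2) = insert (Join t1 t2) (nodes t1 \<union> nodes t2)"
| "nodes (Add_Vertex v t) = insert (Add_Vertex v t) (nodes t)"
| "nodes (Merge S1 S2 t) = insert (Merge S1 S2 t) (nodes t)"
| "nodes (Adjacency S1 S2 t) = insert (Adjacency S1 S2 t) (nodes t)"

definition scd_labels :: "'v scd \<Rightarrow> 'v set set" where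
  "scd_labels D = (\<Union>t\<in>nodes D. labels (graph_at t))"

definition label_child :: "'v scd \<Rightarrow> 'v set \<Rightarrow> 'v set \<Rightarrow> bool" where
  "label_child D S' S \<longleftrightarrow>
     (\<exists>S1 S2 t. Merge S1 S2 t \<in> nodes D \<and> S = S1 \<union> S2 \<and> (S' = S1 \<or> S' = S2))"

definition label_arc :: "'v scd \<Rightarrow> 'v set \<Rightarrow> 'v set \<Rightarrow> bool" where
  "label_arc D S1 S2 \<longleftrightarrow> (\<exists>t. Adjacency S1 S2 t \<in> nodes D)"

definition scd_of :: "'g scd \<Rightarrow> ('g, 'x) circuit \<Rightarrow> bool" where
  "scd_of D F \<longleftrightarrow>
     valid_scd D \<and> verts (graph_at D) = gates F \<and> arcs (graph_at D) = wires F"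

lemma valid_scd_graph:
  assumes "valid_scd D"
  shows "finite (verts (graph_at D))"
    and "partition_on (verts (graph_at D)) (labels (graph_at D))"
    and "set_mset (arcs (graph_at D)) \<subseteq> verts (graph_at D) \<times> verts (graph_at D)"
proof -
  have "finite (verts (graph_at D)) \<and> partition_on (verts (graph_at D)) (labels (graph_at D)) \<and>
        set_mset (arcs (graph_at D)) \<subseteq> verts (graph_at D) \<times> verts (graph_at D)"
    using assms
  proof (induction D)
    case (Leaf v)
    then show ?case by (auto simp: partition_on_def)
  next
    case (Join t1 t2)
    let ?V1 = "verts (graph_at t1)" and ?L1 = "labels (graph_at t1)"
    let ?V2 = "verts (graph_at t2)" and ?L2 = "labels (graph_at t2)"
    have L: "\<Union>?L1 = ?V1" "disjoint ?L1" "{} \<notin> ?L1" "\<Union>?L2 = ?V2" "disjoint ?L2" "{} \<notin> ?L2"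
      using Join by (auto simp: partition_on_def)
    have "\<Union>?L1 \<inter> \<Union>?L2 = {}" using Join.prems L(1,4) by simp
    then have "disjoint (?L1 \<union> ?L2)" using L(2,5) by (intro disjoint_union)
    then have "partition_on (?V1 \<union> ?V2) (?L1 \<union> ?L2)"
      using L by (auto simp: partition_on_def)
    with Join show ?case by auto
  next
    case (Add_Vertex v t)
    then show ?case by (auto simp: partition_on_def disjoint_def)
  next
    case (Merge S1 S2 t)
    let ?V = "verts (graph_at t)" and ?L = "labels (graph_at t)"
    have L: "\<Union>?L = ?V" "disjoint ?L" "{} \<notin> ?L" "S1 \<in> ?L" "S2 \<in> ?L"
      using Merge by (auto simp: partition_on_def)
    have "\<Union>(insert (S1 \<union> S2) (?L - {S1, S2})) = ?V" using L(1,4,5) by blast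
    moreover have "disjoint (insert (S1 \<union> S2) (?L - {S1, S2}))"
    proof -
      have "(S1 \<union> S2) \<inter> S = {}" if "S \<in> ?L - {S1, S2}" for S
        using L(4,5) disjointD[OF L(2)] that by blast
      moreover have "disjoint (?L - {S1, S2})" using L(2) by (auto simp: disjoint_def)
      ultimately show ?thesis by (auto simp: disjoint_def)
    qed
    moreover have "{} \<notin> insert (S1 \<union> S2) (?L - {S1, S2})" using L(3,4) by auto
    ultimately show ?case using Merge by (auto simp: partition_on_def)
  next
    case (Adjacency S1 S2 t)
    then have "S1 \<subseteq> verts (graph_at t)" "S2 \<subseteq> verts (graph_at t)"
      by (auto simp: partition_on_def)
    moreover from this have "finite (S1 \<times> S2)"
      using Adjacency by (auto intro: finite_subset)
    ultimately show ?case using Adjacency by auto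
  qed
  then show "finite (verts (graph_at D))"
    and "partition_on (verts (graph_at D)) (labels (graph_at D))"
    and "set_mset (arcs (graph_at D)) \<subseteq> verts (graph_at D) \<times> verts (graph_at D)" by auto
qed


section \<open>Types of labels\<close>

definition not_label :: "('g, 'x) circuit \<Rightarrow> 'g set \<Rightarrow> bool" where
  "not_label F S \<longleftrightarrow> (\<forall>g\<in>S. kind F g = Not_Gate)"

definition unary_label :: "('g, 'x) circuit \<Rightarrow> 'g set \<Rightarrow> bool" where
  "unary_label F S \<longleftrightarrow> (\<forall>g\<in>S. is_Input_Gate (kind F g) \<or> kind F g = Not_Gate)"

definition and_label :: "('g, 'x) circuit \<Rightarrow> 'g set \<Rightarrow> bool" where
  "and_label F S \<longleftrightarrow> (\<forall>g\<in>S. kind F g = And_Gate)"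

definition or_label :: "('g, 'x) circuit \<Rightarrow> 'g set \<Rightarrow> bool" where
  "or_label F S \<longleftrightarrow> (\<forall>g\<in>S. kind F g = Or_Gate)"

definition input_free :: "('g, 'x) circuit \<Rightarrow> 'g set \<Rightarrow> bool" where
  "input_free F S \<longleftrightarrow> (\<forall>g\<in>S. \<not> is_Input_Gate (kind F g))"

definition type_respecting :: "('g, 'x) circuit \<Rightarrow> 'g scd \<Rightarrow> bool" where
  "type_respecting F D \<longleftrightarrow>
     (\<forall>S\<in>scd_labels D. \<not> is_singleton S \<longrightarrow> unary_label F S \<or> and_label F S \<or> or_label F S)"


section \<open>The circuit constructed from a circuit and a decomposition\<close>

text \<open>
  For a non-singleton label \<open>S\<close>, the gate \<open>in(S)\<close> is \<open>In_Gate S\<close> if \<open>S\<close> is an AND or OR label, and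
  the chain of the NOT gates \<open>In_Not1 S\<close> and \<open>In_Not2 S\<close> if \<open>S\<close> is unary. Accordingly \<open>in_head\<close> is
  the gate that receives the wires entering \<open>in(S)\<close>, and \<open>in_out\<close> the gate that emits its output.
\<close>

datatype 'g star_gate =
  Orig 'g
| Oand_Gate "'g set"
| Oor_Gate "'g set"
| In_Gate "'g set"
| In_Not1 "'g set"
| In_Not2 "'g set"

definition oand :: "'g set \<Rightarrow> 'g star_gate" where
  "oand S = (if is_singleton S then Orig (the_elem S) else Oand_Gate S)"

definition oor :: "'g set \<Rightarrow> 'g star_gate" where
  "oor S = (if is_singleton S then Orig (the_elem S) else Oor_Gate S)"

definition in_head :: "('g, 'x) circuit \<Rightarrow> 'g set \<Rightarrow> 'g star_gate" where
  "in_head F S =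
     (if is_singleton S then Orig (the_elem S)
      else if unary_label F S then In_Not1 S else In_Gate S)"

definition in_out :: "('g, 'x) circuit \<Rightarrow> 'g set \<Rightarrow> 'g star_gate" where
  "in_out F S =
     (if is_singleton S then Orig (the_elem S)
      else if unary_label F S then In_Not2 S else In_Gate S)"

definition in_gates :: "('g, 'x) circuit \<Rightarrow> 'g scd \<Rightarrow> 'g star_gate set" where
  "in_gates F D =
     (\<Union>S\<in>{S \<in> scd_labels D. \<not> is_singleton S \<and> input_free F S}. {in_head F S, in_out F S})"

definition pre_gates :: "('g, 'x) circuit \<Rightarrow> 'g scd \<Rightarrow> 'g star_gate set" where
  "pre_gates F D =
     {Orig g | g. {g} \<in> scd_labels D} \<union>
     {Oand_Gate S | S. S \<in> scd_labels D \<and> \<not> is_singleton S} \<union>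
     {Oor_Gate S | S. S \<in> scd_labels D \<and> \<not> is_singleton S} \<union>
     in_gates F D"

fun star_kind :: "('g, 'x) circuit \<Rightarrow> 'g star_gate \<Rightarrow> 'x gate_kind" where
  "star_kind F (Orig g) = kind F g"
| "star_kind F (Oand_Gate S) = And_Gate"
| "star_kind F (Oor_Gate S) = Or_Gate"
| "star_kind F (In_Gate S) = (if and_label F S then And_Gate else Or_Gate)"
| "star_kind F (In_Not1 S) = Not_Gate"
| "star_kind F (In_Not2 S) = Not_Gate"

text \<open>
  The argument \<open>ch\<close> resolves the arbitrary choice between \<open>oand S1\<close> and \<open>oor S1\<close> for an arc from \<open>S1\<close>
  to a label \<open>S2\<close> of NOT gates.
\<close>

inductive_set pre_wires ::
    "('g, 'x) circuit \<Rightarrow> 'g scd \<Rightarrow> ('g set \<Rightarrow> 'g set \<Rightarrow> bool) \<Rightarrow> ('g star_gate \<times> 'g star_gate) set"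
  for F :: "('g, 'x) circuit" and D :: "'g scd" and ch :: "'g set \<Rightarrow> 'g set \<Rightarrow> bool" where
  in_chain: "\<lbrakk>S \<in> scd_labels D; \<not> is_singleton S; input_free F S; unary_label F S\<rbrakk>
    \<Longrightarrow> (In_Not1 S, In_Not2 S) \<in> pre_wires F D ch"
| child_parent_and: "label_child D S1 S2 \<Longrightarrow> (oand S1, oand S2) \<in> pre_wires F D ch"
| child_parent_or: "label_child D S1 S2 \<Longrightarrow> (oor S1, oor S2) \<in> pre_wires F D ch"
| parent_child: "\<lbrakk>label_child D S1 S2; input_free F S2\<rbrakk>
    \<Longrightarrow> (in_out F S2, in_head F S1) \<in> pre_wires F D ch"
| adjacency_and: "\<lbrakk>label_arc D S1 S2; and_label F S2\<rbrakk>
    \<Longrightarrow> (oand S1, in_head F S2) \<in> pre_wires F D ch"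
| adjacency_or: "\<lbrakk>label_arc D S1 S2; or_label F S2\<rbrakk>
    \<Longrightarrow> (oor S1, in_head F S2) \<in> pre_wires F D ch"
| adjacency_not: "\<lbrakk>label_arc D S1 S2; not_label F S2\<rbrakk>
    \<Longrightarrow> (if ch S1 S2 then oand S1 else oor S1, in_head F S2) \<in> pre_wires F D ch"

text \<open>
  The gates that are deleted when gates \<open>in(S)\<close> without inputs are removed iteratively: a gate of
  some \<open>in(S)\<close> goes as soon as every gate that feeds it is gone.
\<close>

inductive_set removed_gates ::
    "('g, 'x) circuit \<Rightarrow> 'g scd \<Rightarrow> ('g set \<Rightarrow> 'g set \<Rightarrow> bool) \<Rightarrow> 'g star_gate set"
  for F :: "('g, 'x) circuit" and D :: "'g scd" and ch :: "'g set \<Rightarrow> 'g set \<Rightarrow> bool" where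
  "\<lbrakk>h \<in> in_gates F D; \<forall>h'. (h', h) \<in> pre_wires F D ch \<longrightarrow> h' \<in> removed_gates F D ch\<rbrakk>
    \<Longrightarrow> h \<in> removed_gates F D ch"

definition star_circuit ::
    "('g, 'x) circuit \<Rightarrow> 'g scd \<Rightarrow> ('g set \<Rightarrow> 'g set \<Rightarrow> bool) \<Rightarrow> ('g star_gate, 'x) circuit" where
  "star_circuit F D ch =
     \<lparr>gates = pre_gates F D - removed_gates F D ch,
      kind = star_kind F,
      wires = mset_set {(h, h') \<in> pre_wires F D ch.
                         h \<notin> removed_gates F D ch \<and> h' \<notin> removed_gates F D ch}\<rparr>"

end

theory Submission
  imports Defs
begin

text \<open>
  The labels form a laminar family. Let the sources of a label \<open>S\<close> be the gates in the labels from
  which there is an arc to \<open>S\<close> or to an ancestor of \<open>S\<close>; for \<open>S = {g}\<close> these are the gates feeding \<open>g\<close>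
  in \<open>F\<close>. Then \<open>in(S)\<close> survives the removal iff \<open>S\<close> has a source, and it computes the conjunction,
  disjunction or value of the sources, while \<open>oand(S)\<close> and \<open>oor(S)\<close> compute the conjunction and
  disjunction of \<open>S\<close>. The assignment of these values satisfies the equations of all gates, which
  determine the values in an acyclic circuit. A cycle is impossible because every path from an
  original gate to the next one follows an arc of \<open>F\<close>.
\<close>

section \<open>Labels of a decomposition\<close>

text \<open>Two losses of information have to be shown harmless. First, sources form a set, although
  arcs have multiplicities and one gate of \<open>F\<close> may reach \<open>in(S)\<close> along
  several wires. Conjunction and disjunction are idempotent, but a NOT gate must have exactly one
  incoming wire. What saves it is its fan-in one in \<open>F\<close>, counted with multiplicity:
  only one arc can reach a NOT label or its ancestors, and that arc starts at a singleton label, for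
  which \<open>oand\<close> and \<open>oor\<close> are the same gate whatever \<open>ch\<close>
  says. Second, wires from parents containing input gates are absent, and the removal deletes more.
  Since no arc can enter a label that contains an input gate, everything absent has an empty set of
  sources, and an empty conjunction or disjunction does not change the value of the gate it would
  have fed.\<close>

lemma self_in_nodes [simp]: "D \<in> nodes D"
  by (cases D) auto

lemma scd_labels_simps [simp]:
  "scd_labels (Leaf v) = {{v}}"
  "scd_labels (Join t1 t2) = scd_labels t1 \<union> scd_labels t2"
  "scd_labels (Add_Vertex v t) = insert {v} (scd_labels t)"
  "scd_labels (Merge S1 S2 t) = insert (S1 \<union> S2) (scd_labels t)"
  "scd_labels (Adjacency S1 S2 t) = scd_labels t"
  using self_in_nodes by (fastforce simp: scd_labels_def)+

lemma label_child_simps [simp]: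
  "label_child (Leaf v) S P \<longleftrightarrow> False"
  "label_child (Join t1 t2) S P \<longleftrightarrow> label_child t1 S P \<or> label_child t2 S P"
  "label_child (Add_Vertex v t) S P \<longleftrightarrow> label_child t S P"
  "label_child (Merge S1 S2 t) S P \<longleftrightarrow> label_child t S P \<or> P = S1 \<union> S2 \<and> (S = S1 \<or> S = S2)"
  "label_child (Adjacency S1 S2 t) S P \<longleftrightarrow> label_child t S P"
  unfolding label_child_def by (simp; metis)+

lemma label_arc_simps [simp]:
  "label_arc (Leaf v) S T \<longleftrightarrow> False"
  "label_arc (Join t1 t2) S T \<longleftrightarrow> label_arc t1 S T \<or> label_arc t2 S T"
  "label_arc (Add_Vertex v t) S T \<longleftrightarrow> label_arc t S T"
  "label_arc (Merge S1 S2 t) S T \<longleftrightarrow> label_arc t S T"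
  "label_arc (Adjacency S1 S2 t) S T \<longleftrightarrow> label_arc t S T \<or> S = S1 \<and> T = S2"
  by (auto simp: label_arc_def)

section \<open>All labels of the tree against the partition at its root\<close>

lemma labels_subset_scd_labels: "labels (graph_at D) \<subseteq> scd_labels D"
  unfolding scd_labels_def using self_in_nodes by blast

lemma top_labels_disjoint:
  assumes "valid_scd D" "S \<in> labels (graph_at D)" "T \<in> labels (graph_at D)" "S \<inter> T \<noteq> {}"
  shows "S = T"
  using valid_scd_graph(2)[OF assms(1)] assms(2-) by (auto simp: partition_on_def disjoint_def)

text \<open>Labels only grow on the way to the root. This reduces questions about arbitrary labels
  to the partition carried by the root.\<close>

lemma scd_label_subset_top:
  assumes "valid_scd D" "S \<in> scd_labels D"
  shows "\<exists>T\<in>labels (graph_at D). S \<subseteq> T"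
  using assms
proof (induction D)
  case (Merge S1 S2 t)
  show ?case
  proof (cases "S = S1 \<union> S2")
    case True
    then show ?thesis by simp
  next
    case False
    then obtain T where "T \<in> labels (graph_at t)" "S \<subseteq> T" using Merge by auto
    then show ?thesis by (cases "T = S1 \<or> T = S2") auto
  qed
qed auto

lemma scd_label_subset_verts:
  assumes "valid_scd D" "S \<in> scd_labels D"
  shows "S \<subseteq> verts (graph_at D)"
  using scd_label_subset_top[OF assms] valid_scd_graph(2)[OF assms(1)]
  by (auto simp: partition_on_def)

lemma scd_label_nonempty: "valid_scd D \<Longrightarrow> S \<in> scd_labels D \<Longrightarrow> S \<noteq> {}"
proof (induction D)
  case (Merge S1 S2 t)
  then have "S1 \<in> scd_labels t" using labels_subset_scd_labels by auto
  with Merge show ?case by auto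
qed auto

lemma finite_scd_labels: "valid_scd D \<Longrightarrow> finite (scd_labels D)"
  by (rule finite_subset[of _ "Pow (verts (graph_at D))"])
    (auto dest: scd_label_subset_verts simp: valid_scd_graph(1))

text \<open>Every vertex enters the tree as a singleton label, and \<open>scd_labels\<close> keeps
  labels that were merged later; hence each gate of \<open>F\<close> has its original gate.\<close>

lemma singleton_scd_label_iff:
  assumes "valid_scd D"
  shows "{g} \<in> scd_labels D \<longleftrightarrow> g \<in> verts (graph_at D)"
proof
  show "{g} \<in> scd_labels D \<Longrightarrow> g \<in> verts (graph_at D)"
    using scd_label_subset_verts[OF assms] by auto
  show "g \<in> verts (graph_at D) \<Longrightarrow> {g} \<in> scd_labels D"
    using assms by (induction D) auto
qed

text \<open>A merge joins two different members of a partition, hence disjoint nonempty sets: the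
  union is strictly larger than both and has at least two elements.\<close>

lemma label_child_props:
  assumes "valid_scd D" "label_child D S P"
  shows "S \<in> scd_labels D \<and> P \<in> scd_labels D \<and> S \<subset> P \<and> \<not> is_singleton P"
  using assms
proof (induction D)
  case (Merge S1 S2 t)
  show ?case
  proof (cases "label_child t S P")
    case True
    then show ?thesis using Merge by auto
  next
    case False
    have L: "S1 \<in> labels (graph_at t)" "S2 \<in> labels (graph_at t)" "S1 \<noteq> S2" "valid_scd t"
      using Merge.prems by auto
    then have ne: "S1 \<in> scd_labels t" "S2 \<in> scd_labels t" "S1 \<noteq> {}" "S2 \<noteq> {}"
      using labels_subset_scd_labels scd_label_nonempty by blast+
    have dj: "S1 \<inter> S2 = {}" using top_labels_disjoint L by blast
    have "\<not> is_singleton (S1 \<union> S2)" 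
    proof
      assume "is_singleton (S1 \<union> S2)"
      then obtain x where "S1 \<union> S2 = {x}" by (auto simp: is_singleton_def)
      then have "S1 = {x}" "S2 = {x}" using ne by (auto simp: Un_singleton_iff)
      with dj show False by simp
    qed
    then show ?thesis using False Merge.prems ne dj by auto
  qed
qed auto

lemma label_arc_labels:
  assumes "valid_scd D" "label_arc D S T"
  shows "S \<in> scd_labels D \<and> T \<in> scd_labels D"
  using assms labels_subset_scd_labels by (induction D) auto

text \<open>Only merges create labels that are not singletons. The two children provide the inputs
  of \<open>oand(S)\<close> and \<open>oor(S)\<close>.\<close>

lemma nonsingleton_label_children:
  assumes "valid_scd D" "S \<in> scd_labels D" "\<not> is_singleton S"
  shows "\<exists>S1 S2. label_child D S1 S \<and> label_child D S2 S \<and> S = S1 \<union> S2"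
  using assms
proof (induction D)
  case (Join t1 t2)
  then show ?case by (auto; blast)
next
  case (Merge S1 S2 t)
  then show ?case by (auto; blast)
qed auto

lemma subset_top_label:
  assumes "valid_scd D" "S \<in> scd_labels D" "T \<in> labels (graph_at D)" "S \<inter> T \<noteq> {}"
  shows "S \<subseteq> T"
  using scd_label_subset_top[OF assms(1,2)] top_labels_disjoint[OF assms(1) _ assms(3)] assms(4)
  by blast

lemma disjoint_verts_labels_disjoint:
  assumes "valid_scd t1" "valid_scd t2" "verts (graph_at t1) \<inter> verts (graph_at t2) = {}"
    and "S \<in> scd_labels t1" "T \<in> scd_labels t2"
  shows "S \<inter> T = {}"
  using scd_label_subset_verts[OF assms(1,4)] scd_label_subset_verts[OF assms(2,5)] assms(3) by blast

text \<open>The labels form a laminar family in which the parent of a label is its least strict superset.\<close>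

lemma parent_least_superset:
  assumes "valid_scd D" "S \<in> scd_labels D" "T \<in> scd_labels D" "S \<subset> T"
  shows "(\<exists>P. label_child D S P) \<and> (\<forall>P. label_child D S P \<longrightarrow> P \<subseteq> T)"
  using assms
proof (induction D arbitrary: T)
  case (Leaf v)
  then show ?case by auto
next
  case (Join t1 t2)
  have v: "valid_scd t1" "valid_scd t2" using Join.prems by auto
  have ne: "S \<noteq> {}" using scd_label_nonempty Join.prems by blast
  have dj: "A \<inter> B = {}" if "A \<in> scd_labels t1" "B \<in> scd_labels t2" for A B
    using disjoint_verts_labels_disjoint[OF v] that Join.prems by auto
  have S: "S \<in> scd_labels t1 \<or> S \<in> scd_labels t2" "\<not> (S \<in> scd_labels t1 \<and> S \<in> scd_labels t2)"
    using Join.prems dj ne by auto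
  have child: "label_child t1 S P \<Longrightarrow> S \<in> scd_labels t1" "label_child t2 S P \<Longrightarrow> S \<in> scd_labels t2" for P
    using label_child_props v by blast+
  from S(1) show ?case
  proof
    assume 1: "S \<in> scd_labels t1"
    then have "T \<in> scd_labels t1" using dj[of S T] ne Join.prems by auto
    then show ?thesis using Join.IH(1)[OF v(1) 1 _ Join.prems(4)] child S(2) 1 by auto
  next
    assume 2: "S \<in> scd_labels t2"
    then have "T \<in> scd_labels t2" using dj[of T S] ne Join.prems by auto
    then show ?thesis using Join.IH(2)[OF v(2) 2 _ Join.prems(4)] child S(2) 2 by auto
  qed
next
  case (Add_Vertex v t)
  have "S \<noteq> {}" using scd_label_nonempty Add_Vertex.prems by blast
  moreover have "v \<notin> T'" if "T' \<in> scd_labels t" for T'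
    using scd_label_subset_verts[of t T'] that Add_Vertex.prems by auto
  ultimately have "S \<in> scd_labels t" "T \<in> scd_labels t" using Add_Vertex.prems by auto
  then show ?case using Add_Vertex by auto
next
  case (Merge S1 S2 t)
  have v: "valid_scd t" and L: "S1 \<in> labels (graph_at t)" "S2 \<in> labels (graph_at t)"
    using Merge.prems by auto
  then have L': "S1 \<in> scd_labels t" "S2 \<in> scd_labels t"
    using labels_subset_scd_labels by blast+
  then have ne: "S \<noteq> {}" "S1 \<noteq> {}" "S2 \<noteq> {}"
    using scd_label_nonempty v Merge.prems by blast+
  \<comment> \<open>\<open>S1\<close> and \<open>S2\<close> belong to the partition at the root of
    \<open>t\<close>, whose members are maximal among the labels of \<open>t\<close>. So neither has
    a parent inside \<open>t\<close>.\<close>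
  have not_below: False if "X \<in> {S1, S2}" "X \<subset> Y" "Y \<in> scd_labels t" for X Y
    using subset_top_label[OF v, of Y X] that L ne by auto
  have St: "S \<in> scd_labels t"
  proof (rule ccontr)
    assume "S \<notin> scd_labels t"
    then have "S = S1 \<union> S2" "T \<in> scd_labels t" using Merge.prems by auto
    then show False using not_below[of S1 T] Merge.prems(4) by blast
  qed
  show ?case
  proof (cases "S = S1 \<or> S = S2")
    case True
    then have "T = S1 \<union> S2" using not_below[of S T] Merge.prems by auto
    moreover have "\<not> label_child t S P" for P
      using not_below[of S P] label_child_props[OF v, of S P] True by auto
    ultimately show ?thesis using True by auto
  next
    case False
    \<comment> \<open>The induction hypothesis needs a superset that is a label of \<open>t\<close>.
      If \<open>T\<close> is the newly merged label, then \<open>S1\<close> or \<open>S2\<close>,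
      whichever contains \<open>S\<close>, takes its place.\<close>
    obtain T' where T': "T' \<in> scd_labels t" "T' \<subseteq> T" "S \<subset> T'"
    proof (cases "T \<in> scd_labels t")
      case True
      then show ?thesis using that Merge.prems by blast
    next
      case nt: False
      then have T: "T = S1 \<union> S2" using Merge.prems by auto
      then have "S \<subset> S1 \<or> S \<subset> S2"
        using subset_top_label[OF v St L(1)] subset_top_label[OF v St L(2)] ne False Merge.prems(4)
        by blast
      then show ?thesis using that L' T by blast
    qed
    have "(\<exists>P. label_child t S P) \<and> (\<forall>P. label_child t S P \<longrightarrow> P \<subseteq> T')"
      by (rule Merge.IH[OF v St T'(1,3)])
    then show ?thesis using False T'(2) by auto
  qed
next
  case (Adjacency S1 S2 t)
  then show ?case by auto
qed

lemma parent_unique: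
  assumes "valid_scd D" "label_child D S P" "label_child D S Q"
  shows "P = Q"
  using parent_least_superset[OF assms(1)] label_child_props[OF assms(1)] assms(2,3) by blast

section \<open>Arcs between labels and arcs between vertices\<close>

lemma arcs_iff_label_arc:
  assumes "valid_scd D"
  shows "(h, g) \<in># arcs (graph_at D) \<longleftrightarrow> (\<exists>S T. label_arc D S T \<and> h \<in> S \<and> g \<in> T)"
  using assms
proof (induction D)
  case (Join t1 t2)
  then show ?case by (simp; blast)
next
  case (Adjacency S1 S2 t)
  then have "S1 \<in> scd_labels t" "S2 \<in> scd_labels t" "valid_scd t"
    using labels_subset_scd_labels by auto
  \<comment> \<open>\<open>mset_set\<close> of an infinite set is empty, so without finiteness the
    new arcs would be lost.\<close>
  then have "finite (S1 \<times> S2)"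
    using scd_label_subset_verts valid_scd_graph(1) finite_subset by (metis finite_SigmaI)
  with Adjacency show ?case by (simp; blast)
qed auto

text \<open>Each adjacency operation contributes its own copy of the arc. This recovers the
  multiplicity that \<open>label_arc\<close> forgets and is what restricts the arcs into NOT
  gates.\<close>

lemma two_label_arcs_count:
  assumes "valid_scd D" "label_arc D S T" "label_arc D S' T'" "(S, T) \<noteq> (S', T')"
    and "h \<in> S \<inter> S'" "g \<in> T \<inter> T'"
  shows "count (arcs (graph_at D)) (h, g) \<ge> 2"
  using assms
proof (induction D)
  case (Join t1 t2)
  have v: "valid_scd t1" "valid_scd t2" using Join.prems by auto
  have "T \<inter> T' = {}" if "label_arc t1 A T" "label_arc t2 B T'" for A B T T'
    using disjoint_verts_labels_disjoint[OF v] label_arc_labels v that Join.prems(1) by (meson valid_scd.simps(2))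
  from this[of S T S' T'] this[of S' T' S T] Join.prems
  consider "label_arc t1 S T" "label_arc t1 S' T'" | "label_arc t2 S T" "label_arc t2 S' T'" by auto
  then show ?case using Join.IH Join.prems v by cases auto
next
  case (Adjacency S1 S2 t)
  then have v: "valid_scd t" and "S1 \<in> scd_labels t" "S2 \<in> scd_labels t"
    using labels_subset_scd_labels by auto
  then have fin: "finite (S1 \<times> S2)"
    using scd_label_subset_verts valid_scd_graph(1) finite_subset by (metis finite_SigmaI)
  show ?case
  proof (cases "label_arc t S T \<and> label_arc t S' T'")
    case True
    then show ?thesis using Adjacency v by auto
  next
    case False
    \<comment> \<open>The two label arcs differ, so only one of them is the current operation; the
      other already lies in \<open>t\<close>. Each supplies one copy of
      \<open>(h, g)\<close>.\<close>
    then have "(S, T) = (S1, S2) \<or> (S', T') = (S1, S2)" "label_arc t S T \<or> label_arc t S' T'"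
      using Adjacency.prems by auto
    then have "(h, g) \<in> S1 \<times> S2" "(h, g) \<in># arcs (graph_at t)"
      using Adjacency.prems arcs_iff_label_arc[OF v] by auto
    then show ?thesis using fin by (simp add: count_mset_set flip: count_greater_zero_iff)
  qed
qed auto

text \<open>
  The gates of \<open>F\<close> whose outputs reach \<open>in(S)\<close>: arcs into \<open>S\<close> itself or into an ancestor of \<open>S\<close>.
\<close>

definition label_sources :: "'v scd \<Rightarrow> 'v set \<Rightarrow> 'v set" where
  "label_sources D S = \<Union>{S1. \<exists>S2. label_arc D S1 S2 \<and> S \<subseteq> S2}"

text \<open>The two unions mirror the two kinds of wires entering \<open>in(S)\<close>: adjacency
  wires, and the wire from the parent. Any arc to a strict superset of \<open>S\<close> is accounted
  for by the parent, which is the least such superset.\<close>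

lemma label_sources_rec:
  assumes "valid_scd D" "S \<in> scd_labels D"
  shows "label_sources D S =
    \<Union>{S1. label_arc D S1 S} \<union> \<Union>{label_sources D P |P. label_child D S P}"
proof
  show "label_sources D S \<subseteq> \<Union>{S1. label_arc D S1 S} \<union> \<Union>{label_sources D P |P. label_child D S P}"
  proof
    fix h assume "h \<in> label_sources D S"
    then obtain S1 S2 where a: "label_arc D S1 S2" "S \<subseteq> S2" "h \<in> S1"
      by (auto simp: label_sources_def)
    show "h \<in> \<Union>{S1. label_arc D S1 S} \<union> \<Union>{label_sources D P |P. label_child D S P}"
    proof (cases "S = S2")
      case True
      then show ?thesis using a by auto
    next
      case False
      then obtain P where P: "label_child D S P" "P \<subseteq> S2"
        using parent_least_superset[OF assms] label_arc_labels[OF assms(1) a(1)] a(2) by blast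
      then have "h \<in> label_sources D P" using a by (auto simp: label_sources_def)
      then show ?thesis using P by blast
    qed
  qed
  show "\<Union>{S1. label_arc D S1 S} \<union> \<Union>{label_sources D P |P. label_child D S P} \<subseteq> label_sources D S"
    using label_child_props[OF assms(1), of S] unfolding label_sources_def by blast
qed


section \<open>Circuits\<close>

lemma fan_in_pos_iff: "fan_in C g > 0 \<longleftrightarrow> (\<exists>h. (h, g) \<in># wires C)"
proof -
  have "fan_in C g > 0 \<longleftrightarrow> (\<exists>e. e \<in># {#e \<in># wires C. snd e = g#})"
    unfolding fan_in_def by (simp add: nonempty_has_size[symmetric] multiset_nonemptyE ex_in_conv)
  then show ?thesis by auto
qed

lemma count_le_fan_in: "count (wires C) (h, g) \<le> fan_in C g"
proof -
  have "count (wires C) (h, g) = count {#e \<in># wires C. snd e = g#} (h, g)" by simp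
  also have "\<dots> \<le> fan_in C g" unfolding fan_in_def by (rule count_le_size)
  finally show ?thesis .
qed

lemma fan_in_mset_set:
  assumes "wires C = mset_set W" "finite W"
  shows "fan_in C g = card {h. (h, g) \<in> W}"
proof -
  have "fan_in C g = card {e \<in> W. snd e = g}"
    unfolding fan_in_def assms(1) by (simp add: filter_mset_mset_set assms(2))
  also have "{e \<in> W. snd e = g} = (\<lambda>h. (h, g)) ` {h. (h, g) \<in> W}" by auto
  also have "card \<dots> = card {h. (h, g) \<in> W}" by (rule card_image) (simp add: inj_on_def)
  finally show ?thesis .
qed

lemma gate_step_cong:
  assumes C: "well_formed_circuit C" and g: "g \<in> gates C"
    and eq: "\<And>h. (h, g) \<in># wires C \<Longrightarrow> u h = v h"
  shows "gate_step C \<alpha> u g = gate_step C \<alpha> v g"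
proof -
  \<comment> \<open>Only fan-in one makes \<open>THE\<close> denote an actual predecessor, to which
    the assumption on \<open>u\<close> and \<open>v\<close> applies.\<close>
  have "((THE h. (h, g) \<in># wires C), g) \<in># wires C" if "kind C g = Not_Gate"
  proof -
    have "fan_in C g = 1" using C g that by (force simp: well_formed_circuit_def)
    from theI'[OF fan_in_one_ex1[OF this]] show ?thesis .
  qed
  then show ?thesis using eq by (auto simp: gate_step_def split: gate_kind.splits)
qed

text \<open>Makes it possible to guess all values and verify one local equation per gate; the
  induction along the wires is done here once and for all.\<close>

lemma gate_value_unique:
  assumes C: "well_formed_circuit C" and val: "\<And>g. g \<in> gates C \<Longrightarrow> val g = gate_step C \<alpha> val g"
    and "g \<in> gates C"
  shows "gate_value C \<alpha> g = val g"
proof -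
  have "wf (set_mset (wires C))"
    using C by (simp add: well_formed_circuit_def finite_acyclic_wf)
  then show ?thesis using \<open>g \<in> gates C\<close>
  proof (induction g rule: wf_induct_rule)
    case (less g)
    have "gate_value C \<alpha> h = val h" if "(h, g) \<in># wires C" for h
    proof -
      have "h \<in> gates C" using C that by (auto simp: well_formed_circuit_def)
      then show ?thesis using less.IH that by blast
    qed
    then have "gate_step C \<alpha> (gate_value C \<alpha>) g = gate_step C \<alpha> val g"
      using gate_step_cong[OF C less.prems] by blast
    then show ?case using gate_value_unfold[OF C less.prems] val[OF less.prems] by simp
  qed
qed

text \<open>The rank of a vertex is the number of its strict ancestors. Along an arc from
  \<open>x\<close> to \<open>y\<close> it grows because \<open>x\<close> is an ancestor of
  \<open>y\<close> but, by acyclicity, not of itself.\<close>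

lemma finite_acyclic_rank:
  assumes "finite R" "acyclic R"
  obtains r :: "'a \<Rightarrow> nat" where "\<And>x y. (x, y) \<in> R \<Longrightarrow> r x < r y"
proof
  fix x y assume xy: "(x, y) \<in> R"
  have fin: "finite {z. (z, y) \<in> R\<^sup>+}"
    by (rule finite_subset[of _ "Domain R"])
      (use assms(1) in \<open>auto simp: finite_Domain dest: tranclD\<close>)
  have "x \<notin> {z. (z, x) \<in> R\<^sup>+}" using assms(2) by (auto simp: acyclic_def)
  moreover have "x \<in> {z. (z, y) \<in> R\<^sup>+}" using xy by auto
  moreover have "{z. (z, x) \<in> R\<^sup>+} \<subseteq> {z. (z, y) \<in> R\<^sup>+}" using xy by (auto intro: trancl_into_trancl)
  ultimately have "{z. (z, x) \<in> R\<^sup>+} \<subset> {z. (z, y) \<in> R\<^sup>+}" by blast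
  then show "card {z. (z, x) \<in> R\<^sup>+} < card {z. (z, y) \<in> R\<^sup>+}" by (rule psubset_card_mono[OF fin])
qed


section \<open>The constructed circuit\<close>

lemma in_head_eq_iff: "in_head F S = in_head F T \<longleftrightarrow> S = T"
  by (auto simp: in_head_def is_singleton_def split: if_splits)

lemma unary_label_input_free_iff: "input_free F S \<Longrightarrow> unary_label F S \<longleftrightarrow> not_label F S"
  by (auto simp: unary_label_def not_label_def input_free_def)

lemma and_label_exclusive: "S \<noteq> {} \<Longrightarrow> and_label F S \<Longrightarrow> \<not> or_label F S \<and> \<not> not_label F S \<and> \<not> unary_label F S"
  by (auto simp: and_label_def or_label_def not_label_def unary_label_def)

lemma or_label_exclusive: "S \<noteq> {} \<Longrightarrow> or_label F S \<Longrightarrow> \<not> and_label F S \<and> \<not> not_label F S \<and> \<not> unary_label F S"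
  by (auto simp: and_label_def or_label_def not_label_def unary_label_def)

lemma not_label_exclusive: "S \<noteq> {} \<Longrightarrow> not_label F S \<Longrightarrow> \<not> and_label F S \<and> \<not> or_label F S \<and> unary_label F S"
  by (auto simp: and_label_def or_label_def not_label_def unary_label_def)

text \<open>Folds the three adjacency rules into one expression. Testing for AND and OR is enough,
  since the target of an arc is input-free and typed, and so consists of NOT gates
  otherwise.\<close>

definition arc_source ::
    "('g, 'x) circuit \<Rightarrow> ('g set \<Rightarrow> 'g set \<Rightarrow> bool) \<Rightarrow> 'g set \<Rightarrow> 'g set \<Rightarrow> 'g star_gate" where
  "arc_source F ch S T =
     (if and_label F T \<or> \<not> or_label F T \<and> ch S T then oand S else oor S)"

lemma in_gates_simps [simp]:
  "Orig g \<notin> in_gates F D" "Oand_Gate S \<notin> in_gates F D" "Oor_Gate S \<notin> in_gates F D"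
  "oand S \<notin> in_gates F D" "oor S \<notin> in_gates F D" "arc_source F ch S T \<notin> in_gates F D"
  by (auto simp: in_gates_def in_head_def in_out_def oand_def oor_def arc_source_def split: if_splits)

lemma removed_gates_subset: "h \<in> removed_gates F D ch \<Longrightarrow> h \<in> in_gates F D"
  by (erule removed_gates.cases) simp

lemma not_removed_simps [simp]:
  "Orig g \<notin> removed_gates F D ch" "Oand_Gate S \<notin> removed_gates F D ch"
  "Oor_Gate S \<notin> removed_gates F D ch" "oand S \<notin> removed_gates F D ch"
  "oor S \<notin> removed_gates F D ch" "arc_source F ch' S T \<notin> removed_gates F D ch"
  by (auto dest!: removed_gates_subset)

text \<open>
  The value each gate is meant to compute, given the values \<open>v\<close> of the gates of \<open>F\<close>. A surviving
  NOT chain \<open>in(S)\<close> has exactly one source, so that the universal quantifier just picks its value.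
\<close>

fun star_value :: "('g, 'x) circuit \<Rightarrow> 'g scd \<Rightarrow> ('g \<Rightarrow> bool) \<Rightarrow> 'g star_gate \<Rightarrow> bool" where
  "star_value F D v (Orig g) \<longleftrightarrow> v g"
| "star_value F D v (Oand_Gate S) \<longleftrightarrow> (\<forall>g\<in>S. v g)"
| "star_value F D v (Oor_Gate S) \<longleftrightarrow> (\<exists>g\<in>S. v g)"
| "star_value F D v (In_Gate S) \<longleftrightarrow>
     (if and_label F S then \<forall>h\<in>label_sources D S. v h else \<exists>h\<in>label_sources D S. v h)"
| "star_value F D v (In_Not1 S) \<longleftrightarrow> \<not> (\<forall>h\<in>label_sources D S. v h)"
| "star_value F D v (In_Not2 S) \<longleftrightarrow> (\<forall>h\<in>label_sources D S. v h)"

lemma star_value_oand: "star_value F D v (oand S) \<longleftrightarrow> (\<forall>g\<in>S. v g)"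
  by (auto simp: oand_def is_singleton_def)

lemma star_value_oor: "star_value F D v (oor S) \<longleftrightarrow> (\<exists>g\<in>S. v g)"
  by (auto simp: oor_def is_singleton_def)

locale decomposed_circuit =
  fixes F :: "('g, 'x) circuit" and D :: "'g scd" and ch :: "'g set \<Rightarrow> 'g set \<Rightarrow> bool"
  assumes wf_F: "well_formed_circuit F"
    and scd_F: "scd_of D F"
    and typed: "type_respecting F D"
begin

abbreviation "star \<equiv> star_circuit F D ch"

definition star_wires :: "('g star_gate \<times> 'g star_gate) set" where
  "star_wires = {(h, h') \<in> pre_wires F D ch. h \<notin> removed_gates F D ch \<and> h' \<notin> removed_gates F D ch}"

lemma valid: "valid_scd D"
  using scd_F by (simp add: scd_of_def)

lemma finite_gates: "finite (gates F)"
  using wf_F by (simp add: well_formed_circuit_def)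

lemma fan_in_ok_F: "g \<in> gates F \<Longrightarrow> fan_in_ok (kind F g) (fan_in F g)"
  using wf_F by (simp add: well_formed_circuit_def)

lemma label_gates: "S \<in> scd_labels D \<Longrightarrow> S \<subseteq> gates F"
  using scd_label_subset_verts[OF valid] scd_F by (simp add: scd_of_def)

lemma singleton_label_iff: "{g} \<in> scd_labels D \<longleftrightarrow> g \<in> gates F"
  using singleton_scd_label_iff[OF valid] scd_F by (simp add: scd_of_def)

lemma finite_label: "S \<in> scd_labels D \<Longrightarrow> finite S"
  using label_gates finite_gates finite_subset by blast

lemmas label_nonempty = scd_label_nonempty[OF valid]
  and child_props = label_child_props[OF valid]
  and arc_labels = label_arc_labels[OF valid]

lemma wire_iff: "(h, g) \<in># wires F \<longleftrightarrow> (\<exists>S T. label_arc D S T \<and> h \<in> S \<and> g \<in> T)"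
  using arcs_iff_label_arc[OF valid] scd_F by (simp add: scd_of_def)

lemma label_sources_singleton: "label_sources D {g} = {h. (h, g) \<in># wires F}"
  by (auto simp: label_sources_def wire_iff)

text \<open>As \<open>S\<close> is nonempty, an arc to \<open>T\<close> gives every gate of
  \<open>T\<close> an incoming wire in \<open>F\<close>, while input gates have fan-in 0.\<close>

lemma arc_input_free:
  assumes "label_arc D S T"
  shows "input_free F T"
  unfolding input_free_def
proof (intro ballI notI)
  fix g assume g: "g \<in> T" "is_Input_Gate (kind F g)"
  obtain h where "h \<in> S" using label_nonempty arc_labels[OF assms] by blast
  then have "fan_in F g > 0" using g assms by (auto simp: fan_in_pos_iff wire_iff)
  moreover have "g \<in> gates F" using g label_gates arc_labels[OF assms] by blast
  ultimately show False using fan_in_ok_F[of g] g(2) by (cases "kind F g") auto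
qed

lemma label_sources_input_free: "label_sources D S \<noteq> {} \<Longrightarrow> input_free F S"
  using arc_input_free by (fastforce simp: label_sources_def input_free_def)

lemma input_free_label_typed:
  assumes "S \<in> scd_labels D" "input_free F S"
  shows "not_label F S \<or> and_label F S \<or> or_label F S"
proof (cases "is_singleton S")
  case True
  then obtain g where "S = {g}" by (auto simp: is_singleton_def)
  then show ?thesis using assms(2)
    by (cases "kind F g") (auto simp: not_label_def and_label_def or_label_def input_free_def)
next
  case False
  then show ?thesis
    using typed assms unary_label_input_free_iff by (auto simp: type_respecting_def)
qed

text \<open>Types pass to subsets. Conversely, \<open>P\<close> has some type, which
  \<open>S\<close> inherits, and a nonempty set cannot have two of them.\<close>

lemma parent_type:
  assumes "label_child D S P" "input_free F P"
  shows "(and_label F S \<longleftrightarrow> and_label F P) \<and> (or_label F S \<longleftrightarrow> or_label F P) \<and>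
    (not_label F S \<longleftrightarrow> not_label F P) \<and> input_free F S"
proof -
  have S: "S \<subseteq> P" "S \<noteq> {}" "P \<in> scd_labels D"
    using child_props[OF assms(1)] label_nonempty by auto
  have "not_label F P \<or> and_label F P \<or> or_label F P"
    using input_free_label_typed S(3) assms(2) by blast
  moreover have "not_label F P \<Longrightarrow> not_label F S" "and_label F P \<Longrightarrow> and_label F S"
    "or_label F P \<Longrightarrow> or_label F S" "input_free F S"
    using S(1) assms(2) by (auto simp: not_label_def and_label_def or_label_def input_free_def)
  ultimately show ?thesis
    using and_label_exclusive[OF S(2)] or_label_exclusive[OF S(2)] not_label_exclusive[OF S(2)] by blast
qed

section \<open>Wires before the removal\<close>

lemma pre_wire_Oand:
  "(h, Oand_Gate S) \<in> pre_wires F D ch \<longleftrightarrow> (\<exists>S'. label_child D S' S \<and> h = oand S')"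
proof
  show "(h, Oand_Gate S) \<in> pre_wires F D ch \<Longrightarrow> \<exists>S'. label_child D S' S \<and> h = oand S'"
    by (erule pre_wires.cases) (auto simp: oand_def oor_def in_head_def split: if_splits)
  show "\<exists>S'. label_child D S' S \<and> h = oand S' \<Longrightarrow> (h, Oand_Gate S) \<in> pre_wires F D ch"
    using child_props pre_wires.child_parent_and[of D _ S F ch] by (auto simp: oand_def[of S])
qed

lemma pre_wire_Oor:
  "(h, Oor_Gate S) \<in> pre_wires F D ch \<longleftrightarrow> (\<exists>S'. label_child D S' S \<and> h = oor S')"
proof
  show "(h, Oor_Gate S) \<in> pre_wires F D ch \<Longrightarrow> \<exists>S'. label_child D S' S \<and> h = oor S'"
    by (erule pre_wires.cases) (auto simp: oand_def oor_def in_head_def split: if_splits)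
  show "\<exists>S'. label_child D S' S \<and> h = oor S' \<Longrightarrow> (h, Oor_Gate S) \<in> pre_wires F D ch"
    using child_props pre_wires.child_parent_or[of D _ S F ch] by (auto simp: oor_def[of S])
qed

lemma pre_wire_In_Not2:
  "(h, In_Not2 S) \<in> pre_wires F D ch \<longleftrightarrow>
    h = In_Not1 S \<and> S \<in> scd_labels D \<and> \<not> is_singleton S \<and> input_free F S \<and> unary_label F S"
proof
  show "(h, In_Not2 S) \<in> pre_wires F D ch \<Longrightarrow>
    h = In_Not1 S \<and> S \<in> scd_labels D \<and> \<not> is_singleton S \<and> input_free F S \<and> unary_label F S"
    by (erule pre_wires.cases) (auto simp: oand_def oor_def in_head_def split: if_splits)
qed (auto intro: pre_wires.in_chain)

text \<open>An original gate is \<open>oand\<close>, \<open>oor\<close> and \<open>in_head\<close>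
  of its singleton label at once. Child-parent wires still never end in \<open>in_head\<close>,
  because a parent is not a singleton.\<close>

lemma pre_wire_in_head:
  "(h, in_head F S) \<in> pre_wires F D ch \<longleftrightarrow>
    (\<exists>P. label_child D S P \<and> input_free F P \<and> h = in_out F P) \<or>
    (\<exists>S1. label_arc D S1 S \<and> h = arc_source F ch S1 S)"
proof
  assume "(h, in_head F S) \<in> pre_wires F D ch"
  then show "(\<exists>P. label_child D S P \<and> input_free F P \<and> h = in_out F P) \<or>
    (\<exists>S1. label_arc D S1 S \<and> h = arc_source F ch S1 S)"
  proof cases
    case (in_chain S')
    then show ?thesis by (auto simp: in_head_def split: if_splits)
  next
    case (child_parent_and S1 S2)
    then show ?thesis using child_props by (auto simp: in_head_def oand_def[of S2] split: if_splits)
  next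
    case (child_parent_or S1 S2)
    then show ?thesis using child_props by (auto simp: in_head_def oor_def[of S2] split: if_splits)
  next
    case (parent_child S1 S2)
    then show ?thesis by (auto simp: in_head_eq_iff)
  next
    case (adjacency_and S1 S2)
    then show ?thesis by (auto simp: in_head_eq_iff arc_source_def)
  next
    case (adjacency_or S1 S2)
    then have "S2 \<noteq> {}" using arc_labels label_nonempty by blast
    then have "h = arc_source F ch S1 S2"
      using or_label_exclusive[of S2 F] adjacency_or by (simp add: arc_source_def)
    with adjacency_or show ?thesis by (auto simp: in_head_eq_iff)
  next
    case (adjacency_not S1 S2)
    then have "S2 \<noteq> {}" using arc_labels label_nonempty by blast
    then have "h = arc_source F ch S1 S2"
      using not_label_exclusive[of S2 F] adjacency_not by (simp add: arc_source_def)
    with adjacency_not show ?thesis by (auto simp: in_head_eq_iff)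
  qed
next
  assume "(\<exists>P. label_child D S P \<and> input_free F P \<and> h = in_out F P) \<or>
    (\<exists>S1. label_arc D S1 S \<and> h = arc_source F ch S1 S)"
  then show "(h, in_head F S) \<in> pre_wires F D ch"
  proof
    assume "\<exists>P. label_child D S P \<and> input_free F P \<and> h = in_out F P"
    then show ?thesis by (auto intro: pre_wires.parent_child)
  next
    assume "\<exists>S1. label_arc D S1 S \<and> h = arc_source F ch S1 S"
    then obtain S1 where S1: "label_arc D S1 S" "h = arc_source F ch S1 S" by blast
    have "S \<in> scd_labels D" "S \<noteq> {}" using arc_labels S1(1) label_nonempty by blast+
    then consider "and_label F S" | "or_label F S" "\<not> and_label F S"
      | "not_label F S" "\<not> and_label F S" "\<not> or_label F S"
      using input_free_label_typed arc_input_free[OF S1(1)] by blast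
    then show ?thesis
    proof cases
      case 1
      then show ?thesis using pre_wires.adjacency_and[OF S1(1)] S1(2) by (simp add: arc_source_def)
    next
      case 2
      then show ?thesis using pre_wires.adjacency_or[OF S1(1)] S1(2) by (simp add: arc_source_def)
    next
      case 3
      then show ?thesis using pre_wires.adjacency_not[OF S1(1), of F ch] S1(2) by (simp add: arc_source_def)
    qed
  qed
qed

section \<open>Survival of the gates \<open>in(S)\<close>\<close>

lemma in_gates_iff:
  "h \<in> in_gates F D \<longleftrightarrow>
    (\<exists>S. S \<in> scd_labels D \<and> \<not> is_singleton S \<and> input_free F S \<and> (h = in_head F S \<or> h = in_out F S))"
  by (auto simp: in_gates_def)

lemma in_out_cases:
  assumes "\<not> is_singleton S"
  obtains "in_out F S = in_head F S" "\<not> unary_label F S"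
  | "in_out F S = In_Not2 S" "in_head F S = In_Not1 S" "unary_label F S"
  using assms by (cases "unary_label F S") (auto simp: in_head_def in_out_def)

lemma in_head_or_out_cases:
  assumes "h = in_head F S \<or> h = in_out F S" "\<not> is_singleton S"
  obtains "h = in_head F S" | "h = In_Not2 S" "in_head F S = In_Not1 S" "unary_label F S"
  using assms in_out_cases by metis

text \<open>A parent that is not input-free has no sources, hence the missing wire does not matter.\<close>

lemma removed_no_sources:
  assumes "h \<in> removed_gates F D ch"
    and "S \<in> scd_labels D" "\<not> is_singleton S" "input_free F S" "h = in_head F S \<or> h = in_out F S"
  shows "label_sources D S = {}"
  using assms
proof (induction h arbitrary: S rule: removed_gates.induct)
  case step: (1 h)
  from step(6,4) show ?case
  proof (cases rule: in_head_or_out_cases)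
    case 1
    have "\<not> label_arc D S1 S" for S1
      using step(2) pre_wire_in_head[of _ S] 1 not_removed_simps(6) by blast
    moreover have "label_sources D P = {}" if P: "label_child D S P" for P
    proof (rule ccontr)
      assume ne: "label_sources D P \<noteq> {}"
      then have "input_free F P" by (rule label_sources_input_free)
      then have "(in_out F P, h) \<in> pre_wires F D ch"
        using P pre_wire_in_head 1 by blast
      then show False using step(2) child_props[OF P] \<open>input_free F P\<close> ne by blast
    qed
    ultimately show ?thesis using label_sources_rec[OF valid step(3)] by auto
  next
    case 2
    then have "(In_Not1 S, h) \<in> pre_wires F D ch"
      using pre_wire_In_Not2 step by blast
    then show ?thesis using step 2(2) by metis
  qed
qed

lemma label_sources_antimono: "S \<subseteq> P \<Longrightarrow> label_sources D P \<subseteq> label_sources D S"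
  unfolding label_sources_def by blast

text \<open>Induction towards the root, where labels grow. An arc into \<open>S\<close> would supply
  a source, so the head can be fed only by the parent, whose sources are among those of
  \<open>S\<close>.\<close>

lemma no_sources_removed:
  assumes "S \<in> scd_labels D" "\<not> is_singleton S" "input_free F S" "label_sources D S = {}"
  shows "in_head F S \<in> removed_gates F D ch \<and> in_out F S \<in> removed_gates F D ch"
  using assms
proof (induction "card (gates F) - card S" arbitrary: S rule: less_induct)
  case less
  have in_S: "in_head F S \<in> in_gates F D" "in_out F S \<in> in_gates F D"
    using less.prems in_gates_iff by blast+
  have head: "in_head F S \<in> removed_gates F D ch"
  proof (rule removed_gates.intros[OF in_S(1)], intro allI impI)
    fix h assume "(h, in_head F S) \<in> pre_wires F D ch"
    moreover have "\<not> label_arc D S1 S" for S1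
    proof
      assume arc: "label_arc D S1 S"
      then have "S1 \<subseteq> label_sources D S" by (auto simp: label_sources_def)
      then show False using arc_labels[OF arc] label_nonempty less.prems(4) by blast
    qed
    ultimately obtain P where P: "label_child D S P" "input_free F P" "h = in_out F P"
      using pre_wire_in_head by blast
    have P': "P \<in> scd_labels D" "S \<subset> P" "\<not> is_singleton P" using child_props[OF P(1)] by auto
    have "card S < card P" by (rule psubset_card_mono[OF finite_label[OF P'(1)] P'(2)])
    moreover have "card P \<le> card (gates F)" by (rule card_mono[OF finite_gates label_gates[OF P'(1)]])
    moreover have "label_sources D P = {}" using label_sources_antimono[of S P] P' less.prems(4) by blast
    ultimately show "h \<in> removed_gates F D ch" using less.hyps[of P] P P' by auto
  qed
  moreover have "in_out F S \<in> removed_gates F D ch"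
    using less.prems(2)
  proof (cases rule: in_out_cases)
    case 1
    then show ?thesis using head by simp
  next
    case 2
    show ?thesis
      by (rule removed_gates.intros[OF in_S(2)]) (use 2 head pre_wire_In_Not2 in auto)
  qed
  ultimately show ?case by blast
qed

lemma in_head_live:
  assumes "S \<in> scd_labels D" "label_sources D S \<noteq> {}"
  shows "in_head F S \<notin> removed_gates F D ch"
proof (cases "is_singleton S")
  case True
  then show ?thesis by (simp add: in_head_def)
next
  case False
  then show ?thesis using removed_no_sources label_sources_input_free assms by blast
qed

text \<open>After the removal, input-freeness of the parent gives way to its having sources, which
  is exactly when \<open>in(P)\<close> survives.\<close>

lemma star_wire_in_head:
  assumes "S \<in> scd_labels D"
  shows "(h, in_head F S) \<in> star_wires \<longleftrightarrow>
    (\<exists>P. label_child D S P \<and> label_sources D P \<noteq> {} \<and> h = in_out F P) \<or>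
    (\<exists>S1. label_arc D S1 S \<and> h = arc_source F ch S1 S)"
    (is "_ \<longleftrightarrow> ?parent \<or> ?arc")
proof
  assume "(h, in_head F S) \<in> star_wires"
  then have *: "(h, in_head F S) \<in> pre_wires F D ch" "h \<notin> removed_gates F D ch"
    by (auto simp: star_wires_def)
  then show "?parent \<or> ?arc"
    using pre_wire_in_head[of h S] no_sources_removed child_props by blast
next
  assume rhs: "?parent \<or> ?arc"
  have pre: "(h, in_head F S) \<in> pre_wires F D ch"
    using rhs pre_wire_in_head[of h S] label_sources_input_free by blast
  \<comment> \<open>Either kind of wire supplies \<open>S\<close> itself with a source, so the head
    of \<open>S\<close> survives together with \<open>h\<close>.\<close>
  have "label_sources D S \<noteq> {} \<and> h \<notin> removed_gates F D ch"
    using rhs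
  proof
    assume ?parent
    then obtain P where P: "label_child D S P" "label_sources D P \<noteq> {}" "h = in_out F P" by blast
    then show ?thesis
      using label_sources_antimono[of S P] child_props[OF P(1)] removed_no_sources[of h P]
        label_sources_input_free by blast
  next
    assume ?arc
    then obtain S1 where S1: "label_arc D S1 S" "h = arc_source F ch S1 S" by blast
    then have "S1 \<subseteq> label_sources D S" by (auto simp: label_sources_def)
    then show ?thesis using S1 arc_labels label_nonempty by fastforce
  qed
  then show "(h, in_head F S) \<in> star_wires"
    using pre in_head_live[OF assms] by (auto simp: star_wires_def)
qed

lemma star_wire_Oand: "(h, Oand_Gate S) \<in> star_wires \<longleftrightarrow> (\<exists>S'. label_child D S' S \<and> h = oand S')"
  by (auto simp: star_wires_def pre_wire_Oand)

lemma star_wire_Oor: "(h, Oor_Gate S) \<in> star_wires \<longleftrightarrow> (\<exists>S'. label_child D S' S \<and> h = oor S')"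
  by (auto simp: star_wires_def pre_wire_Oor)

lemma star_wire_In_Not2:
  assumes "S \<in> scd_labels D" "\<not> is_singleton S" "unary_label F S" "label_sources D S \<noteq> {}"
  shows "(h, In_Not2 S) \<in> star_wires \<longleftrightarrow> h = In_Not1 S"
proof -
  have "in_head F S = In_Not1 S" "in_out F S = In_Not2 S"
    using assms by (auto simp: in_head_def in_out_def)
  moreover have free: "input_free F S" using label_sources_input_free assms by blast
  ultimately have "In_Not1 S \<notin> removed_gates F D ch" "In_Not2 S \<notin> removed_gates F D ch"
    using removed_no_sources[OF _ assms(1,2) free] assms(4) by metis+
  then show ?thesis using assms free by (auto simp: star_wires_def pre_wire_In_Not2)
qed

lemma ex_star_wire_in_head:
  assumes "S \<in> scd_labels D" "label_sources D S \<noteq> {}"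
  shows "\<exists>h. (h, in_head F S) \<in> star_wires"
proof -
  have "(\<exists>S1. label_arc D S1 S) \<or> (\<exists>P. label_child D S P \<and> label_sources D P \<noteq> {})"
    using assms(2) unfolding label_sources_rec[OF valid assms(1)] by blast
  then show ?thesis unfolding star_wire_in_head[OF assms(1)] by blast
qed

text \<open>
  A NOT gate has a single incoming wire in \<open>F\<close>, counted with multiplicity, so at most one adjacency
  operation targets a label containing it, and the source label of that operation is a singleton.
\<close>

lemma not_label_arc_unique:
  assumes "S \<in> scd_labels D" "not_label F S"
    and "label_arc D S1 T1" "S \<subseteq> T1" "label_arc D S2 T2" "S \<subseteq> T2"
  shows "S1 = S2 \<and> T1 = T2 \<and> is_singleton S1"
proof -
  obtain g where g: "g \<in> S" using label_nonempty assms(1) by blast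
  then have fan: "fan_in F g = 1"
    using fan_in_ok_F[of g] label_gates[OF assms(1)] assms(2) by (auto simp: not_label_def)
  then obtain x where x: "\<And>h. (h, g) \<in># wires F \<longleftrightarrow> h = x" using fan_in_one_ex1 by metis
  have "S1 \<subseteq> {x}" "S2 \<subseteq> {x}" using x g assms wire_iff by blast+
  moreover have "S1 \<noteq> {}" "S2 \<noteq> {}" using arc_labels assms label_nonempty by blast+
  ultimately have S: "S1 = {x}" "S2 = {x}" by auto
  have "T1 = T2"
  proof (rule ccontr)
    assume "T1 \<noteq> T2"
    then have "count (arcs (graph_at D)) (x, g) \<ge> 2"
      using two_label_arcs_count[OF valid assms(3,5), of x g] S g assms by auto
    then have "count (wires F) (x, g) \<ge> 2" using scd_F by (simp add: scd_of_def)
    then show False using count_le_fan_in[of F x g] fan by simp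
  qed
  then show ?thesis using S by simp
qed

lemma not_label_sources:
  assumes "S \<in> scd_labels D" "not_label F S" "label_arc D S1 T" "S \<subseteq> T"
  shows "label_sources D S = S1"
proof -
  have "{S1. \<exists>S2. label_arc D S1 S2 \<and> S \<subseteq> S2} = {S1}"
    using not_label_arc_unique[OF assms] assms(3,4) by blast
  then show ?thesis by (simp add: label_sources_def)
qed

lemma ex1_star_wire_in_head:
  assumes "S \<in> scd_labels D" "not_label F S" "label_sources D S \<noteq> {}"
  shows "\<exists>!h. (h, in_head F S) \<in> star_wires"
proof -
  \<comment> \<open>The sources of \<open>P\<close> come from an arc whose target contains
    \<open>P\<close> and hence differs from \<open>S\<close>; with an arc into \<open>S\<close>
    there would be two arcs.\<close>
  have no_both: False if P: "label_child D S P" "label_sources D P \<noteq> {}" and S1: "label_arc D S1 S" for P S1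
  proof -
    obtain S2 T where "label_arc D S2 T" "P \<subseteq> T" using P by (auto simp: label_sources_def)
    moreover have "S \<subset> P" using child_props P by blast
    ultimately show False using not_label_arc_unique[OF assms(1,2) S1] by blast
  qed
  have "h = h'" if "(h, in_head F S) \<in> star_wires" "(h', in_head F S) \<in> star_wires" for h h'
    using that no_both parent_unique[OF valid, of S] not_label_arc_unique[OF assms(1,2)]
    unfolding star_wire_in_head[OF assms(1)] by blast
  then show ?thesis using ex_star_wire_in_head[OF assms(1,3)] by blast
qed

section \<open>Values carried by the wires\<close>

lemma not_wire_value:
  assumes "S \<in> scd_labels D" "not_label F S" "(h, in_head F S) \<in> star_wires"
  shows "star_value F D v h \<longleftrightarrow> (\<forall>x\<in>label_sources D S. v x)"
  using assms(3) unfolding star_wire_in_head[OF assms(1)]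
proof
  assume "\<exists>P. label_child D S P \<and> label_sources D P \<noteq> {} \<and> h = in_out F P"
  then obtain P where P: "label_child D S P" "label_sources D P \<noteq> {}" "h = in_out F P" by blast
  have P': "P \<in> scd_labels D" "S \<subset> P" "\<not> is_singleton P" using child_props[OF P(1)] by auto
  have nP: "not_label F P" using parent_type[OF P(1) label_sources_input_free[OF P(2)]] assms(2) by blast
  then have "unary_label F P" using not_label_exclusive[OF label_nonempty[OF P'(1)]] by blast
  then have h: "h = In_Not2 P" using P P' by (simp add: in_out_def)
  obtain S1 T where "label_arc D S1 T" "P \<subseteq> T" using P by (auto simp: label_sources_def)
  moreover from this have "S \<subseteq> T" using P'(2) by blast
  \<comment> \<open>The arc reaching \<open>P\<close> also reaches \<open>S\<close>, so both have
    the same single source label and the chain of NOT gates passes its value on.\<close>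
  ultimately have "label_sources D S = S1" "label_sources D P = S1"
    using not_label_sources[OF assms(1,2)] not_label_sources[OF P'(1) nP] by auto
  then show ?thesis using h by simp
next
  assume "\<exists>S1. label_arc D S1 S \<and> h = arc_source F ch S1 S"
  then obtain S1 where S1: "label_arc D S1 S" "h = arc_source F ch S1 S" by blast
  \<comment> \<open>On a singleton both outcomes of \<open>ch\<close> yield the same original gate,
    and conjunction and disjunction agree.\<close>
  have "is_singleton S1" using not_label_arc_unique[OF assms(1,2) S1(1) _ S1(1)] by simp
  then obtain x where "S1 = {x}" by (auto simp: is_singleton_def)
  then show ?thesis
    using S1 not_label_sources[OF assms(1,2) S1(1)]
    by (auto simp: arc_source_def star_value_oand star_value_oor)
qed

lemma and_wires_value:
  assumes "S \<in> scd_labels D" "and_label F S"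
  shows "(\<forall>h. (h, in_head F S) \<in> star_wires \<longrightarrow> star_value F D v h) \<longleftrightarrow>
    (\<forall>x\<in>label_sources D S. v x)"
proof -
  have parent: "star_value F D v (in_out F P) \<longleftrightarrow> (\<forall>x\<in>label_sources D P. v x)"
    if P: "label_child D S P" "label_sources D P \<noteq> {}" for P
  proof -
    have "and_label F P" using parent_type[OF P(1) label_sources_input_free[OF P(2)]] assms(2) by blast
    moreover from this have "\<not> unary_label F P"
      using and_label_exclusive[of P F] child_props[OF P(1)] by blast
    ultimately show ?thesis using child_props[OF P(1)] by (simp add: in_out_def)
  qed
  have arc: "star_value F D v (arc_source F ch S1 S) \<longleftrightarrow> (\<forall>x\<in>S1. v x)" for S1
    using assms by (simp add: arc_source_def star_value_oand)
  have "(\<forall>h. (h, in_head F S) \<in> star_wires \<longrightarrow> star_value F D v h) \<longleftrightarrow>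
    (\<forall>P. label_child D S P \<and> label_sources D P \<noteq> {} \<longrightarrow> star_value F D v (in_out F P)) \<and>
    (\<forall>S1. label_arc D S1 S \<longrightarrow> star_value F D v (arc_source F ch S1 S))"
    unfolding star_wire_in_head[OF assms(1)] by blast
  also have "\<dots> \<longleftrightarrow> (\<forall>P. label_child D S P \<longrightarrow> (\<forall>x\<in>label_sources D P. v x)) \<and>
    (\<forall>S1. label_arc D S1 S \<longrightarrow> (\<forall>x\<in>S1. v x))"
  proof -
    \<comment> \<open>A parent without sources has no wire to \<open>S\<close>, which matches an
      empty conjunction.\<close>
    have "(label_child D S P \<and> label_sources D P \<noteq> {} \<longrightarrow> star_value F D v (in_out F P)) \<longleftrightarrow>
      (label_child D S P \<longrightarrow> (\<forall>x\<in>label_sources D P. v x))" for P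
      using parent[of P] by (cases "label_sources D P = {}") auto
    then show ?thesis by (simp only: arc)
  qed
  also have "\<dots> \<longleftrightarrow> (\<forall>x\<in>label_sources D S. v x)"
    unfolding label_sources_rec[OF valid assms(1)] by blast
  finally show ?thesis .
qed

lemma or_wires_value:
  assumes "S \<in> scd_labels D" "or_label F S"
  shows "(\<exists>h. (h, in_head F S) \<in> star_wires \<and> star_value F D v h) \<longleftrightarrow>
    (\<exists>x\<in>label_sources D S. v x)"
proof -
  have parent: "star_value F D v (in_out F P) \<longleftrightarrow> (\<exists>x\<in>label_sources D P. v x)"
    if P: "label_child D S P" "label_sources D P \<noteq> {}" for P
  proof -
    have "or_label F P" using parent_type[OF P(1) label_sources_input_free[OF P(2)]] assms(2) by blast
    moreover from this have "\<not> unary_label F P" "\<not> and_label F P"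
      using or_label_exclusive[of P F] child_props[OF P(1)] by blast+
    ultimately show ?thesis using child_props[OF P(1)] by (simp add: in_out_def)
  qed
  have arc: "star_value F D v (arc_source F ch S1 S) \<longleftrightarrow> (\<exists>x\<in>S1. v x)" for S1
    using assms or_label_exclusive[OF label_nonempty[OF assms(1)], of F]
    by (simp add: arc_source_def star_value_oor)
  have "(\<exists>h. (h, in_head F S) \<in> star_wires \<and> star_value F D v h) \<longleftrightarrow>
    (\<exists>P. label_child D S P \<and> label_sources D P \<noteq> {} \<and> star_value F D v (in_out F P)) \<or>
    (\<exists>S1. label_arc D S1 S \<and> star_value F D v (arc_source F ch S1 S))"
    unfolding star_wire_in_head[OF assms(1)] by blast
  also have "\<dots> \<longleftrightarrow> (\<exists>P. label_child D S P \<and> (\<exists>x\<in>label_sources D P. v x)) \<or>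
    (\<exists>S1. label_arc D S1 S \<and> (\<exists>x\<in>S1. v x))"
  proof -
    \<comment> \<open>Dually, the missing wire from a parent without sources matches an empty
      disjunction.\<close>
    have "(label_child D S P \<and> label_sources D P \<noteq> {} \<and> star_value F D v (in_out F P)) \<longleftrightarrow>
      (label_child D S P \<and> (\<exists>x\<in>label_sources D P. v x))" for P
      using parent[of P] by (cases "label_sources D P = {}") auto
    then show ?thesis by (simp only: arc)
  qed
  also have "\<dots> \<longleftrightarrow> (\<exists>x\<in>label_sources D S. v x)"
    unfolding label_sources_rec[OF valid assms(1)] by blast
  finally show ?thesis .
qed

lemma Oand_wires_value:
  assumes "S \<in> scd_labels D" "\<not> is_singleton S"
  shows "(\<forall>h. (h, Oand_Gate S) \<in> star_wires \<longrightarrow> star_value F D v h) \<longleftrightarrow> (\<forall>g\<in>S. v g)"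
proof -
  have "(\<forall>h. (h, Oand_Gate S) \<in> star_wires \<longrightarrow> star_value F D v h) \<longleftrightarrow>
    (\<forall>S'. label_child D S' S \<longrightarrow> (\<forall>g\<in>S'. v g))"
    unfolding star_wire_Oand using star_value_oand by metis
  also have "\<dots> \<longleftrightarrow> (\<forall>g\<in>S. v g)"
    using nonsingleton_label_children[OF valid assms] child_props[of _ S] by blast
  finally show ?thesis .
qed

lemma Oor_wires_value:
  assumes "S \<in> scd_labels D" "\<not> is_singleton S"
  shows "(\<exists>h. (h, Oor_Gate S) \<in> star_wires \<and> star_value F D v h) \<longleftrightarrow> (\<exists>g\<in>S. v g)"
proof -
  have "(\<exists>h. (h, Oor_Gate S) \<in> star_wires \<and> star_value F D v h) \<longleftrightarrow>
    (\<exists>S'. label_child D S' S \<and> (\<exists>g\<in>S'. v g))"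
    unfolding star_wire_Oor using star_value_oor by metis
  also have "\<dots> \<longleftrightarrow> (\<exists>g\<in>S. v g)"
    using nonsingleton_label_children[OF valid assms] child_props[of _ S] by blast
  finally show ?thesis .
qed

section \<open>Gates, wires and fan-in of the constructed circuit\<close>

lemma oand_pre_gate: "S \<in> scd_labels D \<Longrightarrow> oand S \<in> pre_gates F D"
  by (auto simp: oand_def pre_gates_def is_singleton_def)

lemma oor_pre_gate: "S \<in> scd_labels D \<Longrightarrow> oor S \<in> pre_gates F D"
  by (auto simp: oor_def pre_gates_def is_singleton_def)

lemma in_pre_gates:
  assumes "S \<in> scd_labels D" "input_free F S"
  shows "in_head F S \<in> pre_gates F D" "in_out F S \<in> pre_gates F D"
proof -
  have "in_head F S \<in> pre_gates F D \<and> in_out F S \<in> pre_gates F D"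
  proof (cases "is_singleton S")
    case True
    then show ?thesis
      using assms by (auto simp: in_head_def in_out_def pre_gates_def is_singleton_def)
  next
    case False
    then show ?thesis using assms in_gates_iff by (auto simp: pre_gates_def)
  qed
  then show "in_head F S \<in> pre_gates F D" "in_out F S \<in> pre_gates F D" by auto
qed

lemma pre_wire_pre_gates:
  assumes "(h, h') \<in> pre_wires F D ch"
  shows "h \<in> pre_gates F D \<and> h' \<in> pre_gates F D"
  using assms
proof cases
  case (in_chain S)
  then show ?thesis using in_pre_gates[of S] by (simp add: in_head_def in_out_def)
next
  case (child_parent_and S1 S2)
  then show ?thesis using child_props oand_pre_gate by blast
next
  case (child_parent_or S1 S2)
  then show ?thesis using child_props oor_pre_gate by blast
next
  case (parent_child S1 S2)
  then show ?thesis using child_props in_pre_gates parent_type by blast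
next
  case (adjacency_and S1 S2)
  then show ?thesis using arc_labels oand_pre_gate in_pre_gates arc_input_free by blast
next
  case (adjacency_or S1 S2)
  then show ?thesis using arc_labels oor_pre_gate in_pre_gates arc_input_free by blast
next
  case (adjacency_not S1 S2)
  then show ?thesis using arc_labels oand_pre_gate oor_pre_gate in_pre_gates arc_input_free by auto
qed

lemma finite_pre_gates: "finite (pre_gates F D)"
proof -
  have fin: "finite (scd_labels D)" by (rule finite_scd_labels[OF valid])
  have "{Orig g |g. {g} \<in> scd_labels D} = Orig ` gates F" by (auto simp: singleton_label_iff)
  moreover have "finite {Oand_Gate S |S. S \<in> scd_labels D \<and> \<not> is_singleton S}"
    "finite {Oor_Gate S |S. S \<in> scd_labels D \<and> \<not> is_singleton S}"
    using fin by simp_all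
  moreover have "finite (in_gates F D)" using fin by (simp add: in_gates_def)
  ultimately show ?thesis using finite_gates by (simp add: pre_gates_def)
qed

lemma finite_star_wires: "finite star_wires"
  by (rule finite_subset[of _ "pre_gates F D \<times> pre_gates F D"])
    (auto simp: star_wires_def finite_pre_gates dest: pre_wire_pre_gates)

lemma wires_star: "wires star = mset_set star_wires"
  by (simp add: star_circuit_def star_wires_def)

lemma set_wires_star: "set_mset (wires star) = star_wires"
  by (simp add: wires_star finite_star_wires)

lemma gates_star: "gates star = pre_gates F D - removed_gates F D ch"
  by (simp add: star_circuit_def)

lemma kind_star: "kind star = star_kind F"
  by (simp add: star_circuit_def)

lemma fan_in_star_pos_iff: "fan_in star g > 0 \<longleftrightarrow> (\<exists>h. (h, g) \<in> star_wires)"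
  by (simp add: fan_in_pos_iff set_wires_star)

lemma fan_in_star_one:
  assumes "\<exists>!h. (h, g) \<in> star_wires"
  shows "fan_in star g = 1"
proof -
  obtain h where "{h. (h, g) \<in> star_wires} = {h}" using assms by blast
  then show ?thesis using fan_in_mset_set[OF wires_star finite_star_wires, of g] by simp
qed

text \<open>
  Along a wire of the constructed circuit the following quantity increases, where \<open>r\<close> is a
  topological ranking of \<open>F\<close>: lexicographically, first the largest rank in \<open>S\<close> at \<open>oand(S)\<close> and
  \<open>oor(S)\<close> and the smallest rank in \<open>S\<close> at \<open>in(S)\<close>, and then the level within the label tree.
\<close>

lemma acyclic_pre_wires: "acyclic (pre_wires F D ch)"
proof -
  have "finite (set_mset (wires F))" "acyclic (set_mset (wires F))"
    using wf_F by (auto simp: well_formed_circuit_def)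
  then obtain r :: "'g \<Rightarrow> nat" where r: "\<And>x y. (x, y) \<in># wires F \<Longrightarrow> r x < r y"
    using finite_acyclic_rank by blast
  \<comment> \<open>Each rank of \<open>F\<close> owns a block of length \<open>3 * N + 1\<close>.
    Heads of non-singleton labels use its offsets below \<open>2 * N\<close>, growing as labels
    shrink; the factor 2 leaves a slot for \<open>In_Not2\<close> between a label and its children.
    \<open>oand\<close> and \<open>oor\<close> use offsets from \<open>2 * N + 1\<close> to
    \<open>3 * N\<close>, growing with the label, and an original gate sits at
    \<open>2 * N + 1\<close>, the value for a label of size one. An arc moves to a later block,
    beyond offset \<open>3 * N\<close>.\<close>
  define N where "N = card (gates F)"
  define hi where "hi S = Max (r ` S) * (3 * N + 1)" for S
  define lo where "lo S = Min (r ` S) * (3 * N + 1)" for S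
  define m where "m h = (case h of
      Orig g \<Rightarrow> r g * (3 * N + 1) + 2 * N + 1
    | Oand_Gate S \<Rightarrow> hi S + 2 * N + card S
    | Oor_Gate S \<Rightarrow> hi S + 2 * N + card S
    | In_Gate S \<Rightarrow> lo S + 2 * (N - card S)
    | In_Not1 S \<Rightarrow> lo S + 2 * (N - card S)
    | In_Not2 S \<Rightarrow> lo S + 2 * (N - card S) + 1)" for h
  have m_out: "m (oand S) = hi S + 2 * N + card S" "m (oor S) = hi S + 2 * N + card S" for S
    by (auto simp: m_def oand_def oor_def hi_def is_singleton_def)
  have m_head: "m (in_head F S) \<ge> lo S + 2 * (N - card S)" for S
    by (auto simp: m_def in_head_def lo_def is_singleton_def)
  have m_tail: "m (in_out F S) \<le> lo S + 2 * (N - card S) + 1" if "\<not> is_singleton S" for S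
    using that by (auto simp: m_def in_out_def)
  have card_N: "card S \<le> N" if "S \<in> scd_labels D" for S
    unfolding N_def by (rule card_mono[OF finite_gates label_gates[OF that]])
  have child: "hi S \<le> hi P \<and> lo P \<le> lo S \<and> card S < card P \<and> card P \<le> N"
    if "label_child D S P" for S P
  proof -
    have P: "P \<in> scd_labels D" "S \<subset> P" "S \<noteq> {}" "finite P"
      using child_props[OF that] label_nonempty finite_label by auto
    then have "Max (r ` S) \<le> Max (r ` P)" "Min (r ` P) \<le> Min (r ` S)"
      by (auto intro!: Max_mono Min_antimono)
    then show ?thesis
      using P card_N psubset_card_mono unfolding hi_def lo_def by (metis mult_le_mono1)
  qed
  have arc: "hi S + 3 * N < lo T" and arc_card: "card S \<le> N" if "label_arc D S T" for S T
  proof -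
    have S: "finite S" "S \<noteq> {}" "finite T" "T \<noteq> {}"
      using arc_labels[OF that] label_nonempty finite_label by auto
    have "Max (r ` S) \<in> r ` S" "Min (r ` T) \<in> r ` T" using S by auto
    then obtain x y where "x \<in> S" "y \<in> T" "Max (r ` S) = r x" "Min (r ` T) = r y" by blast
    moreover from this have "r x < r y" using r that wire_iff by blast
    ultimately have "Suc (Max (r ` S)) \<le> Min (r ` T)" by simp
    then have "Suc (Max (r ` S)) * (3 * N + 1) \<le> lo T" unfolding lo_def by (rule mult_le_mono1)
    then show "hi S + 3 * N < lo T" unfolding hi_def by simp
    show "card S \<le> N" using card_N arc_labels[OF that] by blast
  qed
  have "m h < m h'" if "(h, h') \<in> pre_wires F D ch" for h h'
    using that
  proof cases
    case (in_chain S)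
    then show ?thesis by (simp add: m_def)
  next
    case (child_parent_and S1 S2)
    then show ?thesis using child[of S1 S2] by (simp add: m_out)
  next
    case (child_parent_or S1 S2)
    then show ?thesis using child[of S1 S2] by (simp add: m_out)
  next
    case (parent_child S1 S2)
    have "m h \<le> lo S2 + 2 * (N - card S2) + 1" using parent_child m_tail child_props by blast
    also have "\<dots> < lo S1 + 2 * (N - card S1)" using child[OF parent_child(3)] by linarith
    also have "\<dots> \<le> m h'" using m_head parent_child by blast
    finally show ?thesis .
  next
    case (adjacency_and S1 S2)
    then show ?thesis
      using arc[OF adjacency_and(3)] arc_card[OF adjacency_and(3)] m_head[of S2] m_out(1)[of S1] by simp
  next
    case (adjacency_or S1 S2)
    then show ?thesis
      using arc[OF adjacency_or(3)] arc_card[OF adjacency_or(3)] m_head[of S2] m_out(2)[of S1] by simp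
  next
    case (adjacency_not S1 S2)
    have "m h = hi S1 + 2 * N + card S1" using adjacency_not m_out by simp
    then show ?thesis
      using arc[OF adjacency_not(3)] arc_card[OF adjacency_not(3)] m_head[of S2] adjacency_not(2) by simp
  qed
  then have "pre_wires F D ch \<subseteq> measure m" by auto
  then show ?thesis using wf_subset wf_measure wf_acyclic by blast
qed

section \<open>Kinds of surviving gates and well-formedness\<close>

lemma star_gate_cases:
  assumes "h \<in> gates star"
  obtains (input) g x where "h = Orig g" "g \<in> gates F" "kind F g = Input_Gate x"
  | (oand) S where "h = Oand_Gate S" "S \<in> scd_labels D" "\<not> is_singleton S"
  | (oor) S where "h = Oor_Gate S" "S \<in> scd_labels D" "\<not> is_singleton S"
  | (head) S where "h = in_head F S" "S \<in> scd_labels D" "label_sources D S \<noteq> {}" "input_free F S"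
  | (not2) S where "h = In_Not2 S" "S \<in> scd_labels D" "\<not> is_singleton S" "unary_label F S"
      "label_sources D S \<noteq> {}"
proof -
  have h: "h \<in> pre_gates F D" "h \<notin> removed_gates F D ch" using assms by (auto simp: gates_star)
  then consider (orig) g where "h = Orig g" "{g} \<in> scd_labels D"
    | (oand) S where "h = Oand_Gate S" "S \<in> scd_labels D" "\<not> is_singleton S"
    | (oor) S where "h = Oor_Gate S" "S \<in> scd_labels D" "\<not> is_singleton S"
    | (inner) S where "S \<in> scd_labels D" "\<not> is_singleton S" "input_free F S"
      "h = in_head F S \<or> h = in_out F S"
    unfolding pre_gates_def in_gates_def by blast
  then show thesis
  proof cases
    case orig
    show thesis
    proof (cases "is_Input_Gate (kind F g)")
      case True
      then show thesis using orig input singleton_label_iff by (auto simp: is_Input_Gate_def)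
    next
      case False
      \<comment> \<open>An original gate that is not an input is \<open>in_head\<close> of its own
        singleton label, so it is treated together with the new gates in the case
        \<open>head\<close>.\<close>
      have "g \<in> gates F" using orig singleton_label_iff by blast
      then have "fan_in F g > 0" using fan_in_ok_F[of g] False by (cases "kind F g") auto
      then have "label_sources D {g} \<noteq> {}" by (auto simp: label_sources_singleton fan_in_pos_iff)
      then show thesis using head[of "{g}"] orig label_sources_input_free by (simp add: in_head_def)
    qed
  next
    case inner
    have live: "label_sources D S \<noteq> {}" using inner no_sources_removed h by blast
    from inner(4,2) show thesis
      by (cases rule: in_head_or_out_cases) (use head not2 inner live in blast)+
  qed (use oand oor in blast)+
qed

lemma star_kind_in_head:
  assumes "S \<in> scd_labels D" "input_free F S"
  shows "not_label F S \<Longrightarrow> star_kind F (in_head F S) = Not_Gate"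
    "and_label F S \<Longrightarrow> star_kind F (in_head F S) = And_Gate"
    "or_label F S \<Longrightarrow> star_kind F (in_head F S) = Or_Gate"
proof -
  have ne: "S \<noteq> {}" using label_nonempty assms by blast
  show "not_label F S \<Longrightarrow> star_kind F (in_head F S) = Not_Gate"
    using not_label_exclusive[OF ne, of F] by (auto simp: in_head_def is_singleton_def not_label_def)
  show "and_label F S \<Longrightarrow> star_kind F (in_head F S) = And_Gate"
    using and_label_exclusive[OF ne, of F] by (auto simp: in_head_def is_singleton_def and_label_def)
  show "or_label F S \<Longrightarrow> star_kind F (in_head F S) = Or_Gate"
    using or_label_exclusive[OF ne, of F] by (auto simp: in_head_def is_singleton_def or_label_def)
qed

lemma well_formed_star: "well_formed_circuit star"
  unfolding well_formed_circuit_def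
proof (intro conjI ballI)
  show "finite (gates star)" using finite_pre_gates by (simp add: gates_star)
  show "set_mset (wires star) \<subseteq> gates star \<times> gates star"
    unfolding set_wires_star gates_star by (auto simp: star_wires_def dest: pre_wire_pre_gates)
  show "acyclic (set_mset (wires star))"
    unfolding set_wires_star
    by (rule acyclic_subset[OF acyclic_pre_wires]) (auto simp: star_wires_def)
  fix h assume "h \<in> gates star"
  then show "fan_in_ok (kind star h) (fan_in star h)"
  proof (cases rule: star_gate_cases)
    case (input g x)
    have g: "{g} \<in> scd_labels D" "\<not> input_free F {g}"
      using input singleton_label_iff by (auto simp: input_free_def)
    \<comment> \<open>An arc into \<open>{g}\<close>, or a parent with sources, would force
      \<open>{g}\<close> to be input-free.\<close>
    have "(h', in_head F {g}) \<notin> star_wires" for h'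
      unfolding star_wire_in_head[OF g(1)]
      using g(2) arc_input_free label_sources_input_free parent_type by blast
    then have "\<not> fan_in star h > 0"
      unfolding fan_in_star_pos_iff using input by (simp add: in_head_def)
    then show ?thesis using input by (simp add: kind_star)
  next
    case (oand S)
    then have "fan_in star h > 0"
      unfolding fan_in_star_pos_iff using nonsingleton_label_children[OF valid] star_wire_Oand by blast
    then show ?thesis using oand by (simp add: kind_star)
  next
    case (oor S)
    then have "fan_in star h > 0"
      unfolding fan_in_star_pos_iff using nonsingleton_label_children[OF valid] star_wire_Oor by blast
    then show ?thesis using oor by (simp add: kind_star)
  next
    case (head S)
    have pos: "fan_in star h > 0" unfolding fan_in_star_pos_iff using head ex_star_wire_in_head by blast
    have one: "fan_in star h = 1" if "not_label F S"
      using fan_in_star_one ex1_star_wire_in_head[OF head(2) that head(3)] head(1) by blast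
    show ?thesis
      using input_free_label_typed[OF head(2,4)] star_kind_in_head[OF head(2,4)] pos one head(1)
      by (auto simp: kind_star)
  next
    case (not2 S)
    then have "\<exists>!h'. (h', h) \<in> star_wires" using star_wire_In_Not2[OF not2(2-5)] by simp
    then show ?thesis using fan_in_star_one not2(1) by (simp add: kind_star)
  qed
qed

section \<open>The intended values satisfy the gate equations\<close>

lemma star_value_in_head:
  fixes \<alpha> :: "'x \<Rightarrow> bool"
  defines "v \<equiv> gate_value F \<alpha>"
  assumes S: "S \<in> scd_labels D" "input_free F S" "label_sources D S \<noteq> {}"
  shows "not_label F S \<Longrightarrow> star_value F D v (in_head F S) \<longleftrightarrow> \<not> (\<forall>x\<in>label_sources D S. v x)"
    "and_label F S \<Longrightarrow> star_value F D v (in_head F S) \<longleftrightarrow> (\<forall>x\<in>label_sources D S. v x)"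
    "or_label F S \<Longrightarrow> star_value F D v (in_head F S) \<longleftrightarrow> (\<exists>x\<in>label_sources D S. v x)"
proof -
  have ne: "S \<noteq> {}" using label_nonempty S by blast
  have "(not_label F S \<longrightarrow> star_value F D v (in_head F S) \<longleftrightarrow> \<not> (\<forall>x\<in>label_sources D S. v x)) \<and>
    (and_label F S \<longrightarrow> star_value F D v (in_head F S) \<longleftrightarrow> (\<forall>x\<in>label_sources D S. v x)) \<and>
    (or_label F S \<longrightarrow> star_value F D v (in_head F S) \<longleftrightarrow> (\<exists>x\<in>label_sources D S. v x))"
  proof (cases "is_singleton S")
    case True
    then obtain g where g: "S = {g}" by (auto simp: is_singleton_def)
    then have gF: "g \<in> gates F" using S singleton_label_iff by blast
    have head: "in_head F S = Orig g" using g by (simp add: in_head_def)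
    \<comment> \<open>The sources of \<open>{g}\<close> are the predecessors of \<open>g\<close>, so
      for a singleton the claim is the equation of \<open>g\<close> in \<open>F\<close>; for larger
      labels it is built into \<open>star_value\<close>.\<close>
    have v: "v g = gate_step F \<alpha> v g" unfolding v_def by (rule gate_value_unfold[OF wf_F gF])
    have src: "x \<in> label_sources D S \<longleftrightarrow> (x, g) \<in># wires F" for x
      using label_sources_singleton g by auto
    have "v (THE h. (h, g) \<in># wires F) \<longleftrightarrow> (\<forall>x\<in>label_sources D S. v x)" if "not_label F S"
    proof -
      have "fan_in F g = 1" using that g fan_in_ok_F[OF gF] by (simp add: not_label_def)
      then obtain y where "\<And>h. (h, g) \<in># wires F \<longleftrightarrow> h = y" using fan_in_one_ex1 by metis
      then show ?thesis using src by auto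
    qed
    moreover have "kind F g = Not_Gate" if "not_label F S" using that g by (simp add: not_label_def)
    moreover have "kind F g = And_Gate" if "and_label F S" using that g by (simp add: and_label_def)
    moreover have "kind F g = Or_Gate" if "or_label F S" using that g by (simp add: or_label_def)
    ultimately show ?thesis
      using v unfolding head star_value.simps gate_step_def Ball_def Bex_def src by auto
  next
    case False
    have "in_head F S = In_Not1 S" if "not_label F S"
      using not_label_exclusive[OF ne that] False by (simp add: in_head_def)
    moreover have "in_head F S = In_Gate S" if "and_label F S"
      using and_label_exclusive[OF ne that] False by (simp add: in_head_def)
    moreover have "in_head F S = In_Gate S \<and> \<not> and_label F S" if "or_label F S"
      using or_label_exclusive[OF ne that] False by (simp add: in_head_def)
    ultimately show ?thesis by simp
  qed
  then show "not_label F S \<Longrightarrow> star_value F D v (in_head F S) \<longleftrightarrow> \<not> (\<forall>x\<in>label_sources D S. v x)"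
    "and_label F S \<Longrightarrow> star_value F D v (in_head F S) \<longleftrightarrow> (\<forall>x\<in>label_sources D S. v x)"
    "or_label F S \<Longrightarrow> star_value F D v (in_head F S) \<longleftrightarrow> (\<exists>x\<in>label_sources D S. v x)"
    by blast+
qed

lemma star_value_step:
  fixes \<alpha> :: "'x \<Rightarrow> bool"
  defines "v \<equiv> gate_value F \<alpha>"
  assumes "h \<in> gates star"
  shows "star_value F D v h = gate_step star \<alpha> (star_value F D v) h"
  using assms(2)
proof (cases rule: star_gate_cases)
  case (input g x)
  have "v g = gate_step F \<alpha> v g" unfolding v_def by (rule gate_value_unfold[OF wf_F input(2)])
  then show ?thesis using input by (simp add: gate_step_def kind_star)
next
  case (oand S)
  then show ?thesis
    using Oand_wires_value[of S v] by (simp add: gate_step_def kind_star set_wires_star)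
next
  case (oor S)
  then show ?thesis
    using Oor_wires_value[of S v] by (simp add: gate_step_def kind_star set_wires_star)
next
  case (head S)
  note head_value = star_value_in_head[OF head(2,4,3), of \<alpha>, folded v_def]
  from input_free_label_typed[OF head(2,4)] consider
    (n) "not_label F S" | (a) "and_label F S" | (r) "or_label F S" by blast
  then show ?thesis
  proof cases
    case n
    have "(THE h'. (h', h) \<in> star_wires, h) \<in> star_wires"
      using theI'[OF ex1_star_wire_in_head[OF head(2) n head(3)]] head(1) by simp
    then have "star_value F D v (THE h'. (h', h) \<in> star_wires) \<longleftrightarrow> (\<forall>x\<in>label_sources D S. v x)"
      using not_wire_value[OF head(2) n] head(1) by blast
    then show ?thesis
      using head_value(1)[OF n] star_kind_in_head(1)[OF head(2,4) n] head(1)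
      by (simp add: gate_step_def kind_star set_wires_star)
  next
    case a
    then show ?thesis
      using head_value(2)[OF a] star_kind_in_head(2)[OF head(2,4) a] and_wires_value[OF head(2) a, of v] head(1)
      by (simp add: gate_step_def kind_star set_wires_star)
  next
    case r
    then show ?thesis
      using head_value(3)[OF r] star_kind_in_head(3)[OF head(2,4) r] or_wires_value[OF head(2) r, of v] head(1)
      by (simp add: gate_step_def kind_star set_wires_star)
  qed
next
  case (not2 S)
  then show ?thesis
    using star_wire_In_Not2[OF not2(2-5)] by (simp add: gate_step_def kind_star set_wires_star)
qed

lemma Orig_in_gates_star: "Orig g \<in> gates star \<longleftrightarrow> g \<in> gates F"
  by (auto simp: gates_star pre_gates_def singleton_label_iff)

lemma input_gates_star: "input_gates star = Orig ` input_gates F"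
proof -
  have "\<exists>g. h = Orig g" if "is_Input_Gate (star_kind F h)" for h
    using that by (cases h) (auto split: if_splits)
  then show ?thesis
    unfolding input_gates_def kind_star using Orig_in_gates_star by fastforce
qed

end

theorem theorem2:
  fixes F :: "('g, 'x) circuit"
    and D :: "'g scd"
    and ch :: "'g set \<Rightarrow> 'g set \<Rightarrow> bool"
  assumes "well_formed_circuit F"
    and "scd_of D F"
    and "type_respecting F D"
  shows "well_formed_circuit (star_circuit F D ch) \<and>
    input_gates (star_circuit F D ch) = Orig ` input_gates F \<and>
    (\<forall>g. Orig g \<in> gates (star_circuit F D ch) \<longleftrightarrow> g \<in> gates F) \<and>
    (\<forall>g\<in>gates F. gate_function (star_circuit F D ch) (Orig g) = gate_function F g)"
proof -
  interpret decomposed_circuit F D ch using assms by unfold_locales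
  have "gate_value star \<alpha> (Orig g) = gate_value F \<alpha> g" if "g \<in> gates F" for \<alpha> g
    using gate_value_unique[OF well_formed_star star_value_step, of "Orig g" \<alpha>] that
      Orig_in_gates_star by simp
  then show ?thesis
    using well_formed_star input_gates_star Orig_in_gates_star by (auto simp: gate_function_def)
qed

end
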